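(* For all $\varepsilon>0$, $$P\big(V_N(\varphi^N)>\vartheta(1-\varepsilon)\big)\xrightarrow[N\to\infty]{}1,$$ where $\vartheta:=4g^2\sum_{k=2}^\infty\rho(k)\rho(k-1)+g^2(2^{H+\frac12}-2)$.
   Context: Fix $H\in(\frac12,1)$, $\sigma>0$, $s_0>0$. Put $c_H:=\sqrt{\frac{2H\,\Gamma(\frac32-H)}{\Gamma(H+\frac12)\Gamma(2-2H)}}>0$, $C_H:=(H-\frac12)c_H$ and $g:=\frac{\sigma c_H}{H+\frac12}$. Let $h:=\frac H2+\frac14$ and $\rho(n):=\frac12[(n+1)^{2h}+(n-1)^{2h}-2n^{2h}]$, $n\ge1$. Let $(\xi_i)_{i\ge1}$ be i.i.d. random variables on a probability space $(\Omega,\mathcal{F},P)$ with $P(\xi_1=1)=P(\xi_1=-1)=\frac12$; $\mathcal{F}_0:=\{\emptyset,\Omega\}$, $\mathcal{F}_i:=\sigma(\xi_1,\dots,\xi_i)$. For $n\ge1$ and $1\le i\le n-1$ let $$j_n(i):=\sigma C_H\int_{i-1}^{i}x^{\frac12-H}\left(\int_0^1(v+n-1)^{H-\frac12}(v+n-1-x)^{H-\frac32}dv\right)dx,$$ $$g_n:=\sigma C_H\int_{n-1}^{n}x^{\frac12-H}(n-x)^{H-\frac12}\left(\int_0^1(y(n-x)+x)^{H-\frac12}y^{H-\frac32}dy\right)dx,$$ $\mathcal{Y}_n:=\sum_{i=1}^{n-1}j_n(i)\xi_i$ and $X_n:=\mathcal{Y}_n+g_n\xi_n$. The $N$-fractional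 binary market (zero drift) has bond identically $1$ and stock $S_0^N=s_0$, $S_n^N=(1+\frac{X_n}{N^H})S_{n-1}^N$, $1\le n\le N$. Consider $N$ large enough that $S_k^N>0$ for all $0\le k\le N$ (this holds for all sufficiently large $N$). The strategy $\varphi^N=(\varphi^{0,N},\varphi^{1,N})$ (bond units, stock units, indexed by $n\in\{-1,0,\dots,N\}$) has stock position $\varphi_{-1}^{1,N}:=\varphi_0^{1,N}:=0$ and $\varphi_k^{1,N}:=N^{H-1}\frac{X_k}{S_k^N}$ for $1\le k\le N$; its bond position is given by $\varphi_{-1}^{0,N}:=0$ and the frictionless self-financing condition $\varphi_n^{0,N}-\varphi_{n-1}^{0,N}=-(\varphi_n^{1,N}-\varphi_{n-1}^{1,N})S_n^N$, $0\le n\le N$. Its value process is $V_n(\varphi^N):=\varphi_n^{0,N}+\varphi_n^{1,N}S_n^N$. *)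

theory Defs
  imports "HOL-Probability.Probability"
begin

section \<open>Constants\<close>

definition c_const :: "real \<Rightarrow> real" where
  "c_const H = sqrt (2 * H * Gamma (3/2 - H) / (Gamma (H + 1/2) * Gamma (2 - 2 * H)))"

definition C_const :: "real \<Rightarrow> real" where
  "C_const H = (H - 1/2) * c_const H"

definition g_const :: "real \<Rightarrow> real \<Rightarrow> real" where
  "g_const H \<sigma> = \<sigma> * c_const H / (H + 1/2)"

definition h_exp :: "real \<Rightarrow> real" where
  "h_exp H = H / 2 + 1/4"

definition rho :: "real \<Rightarrow> nat \<Rightarrow> real" where
  "rho H n = 1/2 * ((real n + 1) powr (2 * h_exp H) + (real n - 1) powr (2 * h_exp H)
                    - 2 * real n powr (2 * h_exp H))"

text \<open>The series over \<open>k \<ge> 2\<close> of \<open>rho H k * rho H (k - 1)\<close> is written with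
  \<open>k\<close> shifted by 2.\<close>

definition theta :: "real \<Rightarrow> real \<Rightarrow> real" where
  "theta H \<sigma> = 4 * (g_const H \<sigma>)\<^sup>2 * (\<Sum>k. rho H (k + 2) * rho H (k + 1))
               + (g_const H \<sigma>)\<^sup>2 * (2 powr (H + 1/2) - 2)"


section \<open>The fractional binary markets\<close>

text \<open>Every base of \<open>powr\<close> below is nonnegative on the range of integration
  (for \<open>1 \<le> i \<le> n - 1\<close> in \<open>j_coef\<close>, and \<open>n \<ge> 1\<close> in \<open>g_coef\<close>). A base
  vanishes only on a null set, so the convention \<open>0 powr a = 0\<close> does not affect the integrals.\<close>

definition j_coef :: "real \<Rightarrow> real \<Rightarrow> nat \<Rightarrow> nat \<Rightarrow> real" where
  "j_coef H \<sigma> n i = \<sigma> * C_const H *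
     (LBINT x:{real i - 1..real i}. x powr (1/2 - H) *
        (LBINT v:{0..1}. (v + real n - 1) powr (H - 1/2) * (v + real n - 1 - x) powr (H - 3/2)))"

definition g_coef :: "real \<Rightarrow> real \<Rightarrow> nat \<Rightarrow> real" where
  "g_coef H \<sigma> n = \<sigma> * C_const H *
     (LBINT x:{real n - 1..real n}. x powr (1/2 - H) * (real n - x) powr (H - 1/2) *
        (LBINT y:{0..1}. (y * (real n - x) + x) powr (H - 1/2) * y powr (H - 3/2)))"

definition Y_proc :: "real \<Rightarrow> real \<Rightarrow> (nat \<Rightarrow> 'a \<Rightarrow> real) \<Rightarrow> nat \<Rightarrow> 'a \<Rightarrow> real" where
  "Y_proc H \<sigma> \<xi> n \<omega> = (\<Sum>i = 1..n - 1. j_coef H \<sigma> n i * \<xi> i \<omega>)"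

definition X_proc :: "real \<Rightarrow> real \<Rightarrow> (nat \<Rightarrow> 'a \<Rightarrow> real) \<Rightarrow> nat \<Rightarrow> 'a \<Rightarrow> real" where
  "X_proc H \<sigma> \<xi> n \<omega> = Y_proc H \<sigma> \<xi> n \<omega> + g_coef H \<sigma> n * \<xi> n \<omega>"

primrec stock_price ::
  "real \<Rightarrow> real \<Rightarrow> real \<Rightarrow> (nat \<Rightarrow> 'a \<Rightarrow> real) \<Rightarrow> nat \<Rightarrow> nat \<Rightarrow> 'a \<Rightarrow> real" where
  "stock_price H \<sigma> s0 \<xi> N 0 \<omega> = s0"
| "stock_price H \<sigma> s0 \<xi> N (Suc n) \<omega> =
     (1 + X_proc H \<sigma> \<xi> (Suc n) \<omega> / real N powr H) * stock_price H \<sigma> s0 \<xi> N n \<omega>"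


section \<open>Self-financing strategies and their value\<close>

text \<open>Positions are indexed by integers because trading starts from the position at time \<open>-1\<close>;
  prices are indexed by \<open>0, 1, \<dots>\<close> and the bond price is constantly 1. Given the price path \<open>S\<close>
  and the stock positions \<open>\<phi>1\<close>, \<open>bond_position S \<phi>1\<close> gives the bond positions determined by
  zero initial bond holdings and the frictionless self-financing condition. Positions
  at times before \<open>-1\<close> are irrelevant and set to 0.\<close>

function bond_position :: "(nat \<Rightarrow> real) \<Rightarrow> (int \<Rightarrow> real) \<Rightarrow> int \<Rightarrow> real" where
  "bond_position S \<phi>1 n =
     (if n < 0 then 0
      else bond_position S \<phi>1 (n - 1) - (\<phi>1 n - \<phi>1 (n - 1)) * S (nat n))"
  by auto
termination
  by (relation "Wellfounded.measure (\<lambda>(S, \<phi>1, n). nat (n + 1))") auto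

declare bond_position.simps [simp del]

lemma bond_position_initial: "bond_position S \<phi>1 (-1) = 0"
  by (simp add: bond_position.simps)

lemma bond_position_self_financing:
  assumes "0 \<le> n"
  shows "bond_position S \<phi>1 n - bond_position S \<phi>1 (n - 1) = - (\<phi>1 n - \<phi>1 (n - 1)) * S (nat n)"
  using assms by (simp add: bond_position.simps [of S \<phi>1 n] algebra_simps)

definition portfolio_value ::
  "(nat \<Rightarrow> real) \<Rightarrow> (int \<Rightarrow> real) \<Rightarrow> (int \<Rightarrow> real) \<Rightarrow> nat \<Rightarrow> real" where
  "portfolio_value S \<phi>0 \<phi>1 n = \<phi>0 (int n) + \<phi>1 (int n) * S n"


section \<open>The strategy\<close>

text \<open>The quotient by the stock price is meaningful once all \<open>N\<close>-market prices are
  positive, which holds almost surely for all sufficiently large \<open>N\<close>.\<close>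

definition strat_stock ::
  "real \<Rightarrow> real \<Rightarrow> real \<Rightarrow> (nat \<Rightarrow> 'a \<Rightarrow> real) \<Rightarrow> nat \<Rightarrow> 'a \<Rightarrow> int \<Rightarrow> real" where
  "strat_stock H \<sigma> s0 \<xi> N \<omega> k =
     (if k \<le> 0 then 0
      else real N powr (H - 1) * (X_proc H \<sigma> \<xi> (nat k) \<omega> / stock_price H \<sigma> s0 \<xi> N (nat k) \<omega>))"

definition strat_bond ::
  "real \<Rightarrow> real \<Rightarrow> real \<Rightarrow> (nat \<Rightarrow> 'a \<Rightarrow> real) \<Rightarrow> nat \<Rightarrow> 'a \<Rightarrow> int \<Rightarrow> real" where
  "strat_bond H \<sigma> s0 \<xi> N \<omega> =
     bond_position (\<lambda>n. stock_price H \<sigma> s0 \<xi> N n \<omega>) (strat_stock H \<sigma> s0 \<xi> N \<omega>)"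

definition strat_value ::
  "real \<Rightarrow> real \<Rightarrow> real \<Rightarrow> (nat \<Rightarrow> 'a \<Rightarrow> real) \<Rightarrow> nat \<Rightarrow> nat \<Rightarrow> 'a \<Rightarrow> real" where
  "strat_value H \<sigma> s0 \<xi> N n \<omega> =
     portfolio_value (\<lambda>m. stock_price H \<sigma> s0 \<xi> N m \<omega>)
       (strat_bond H \<sigma> s0 \<xi> N \<omega>) (strat_stock H \<sigma> s0 \<xi> N \<omega>) n"

end

theory Submission
  imports Defs
begin

text \<open>
  The gains of the strategy telescope: the position at time \<open>k\<close> is \<open>X k / S k\<close> up to scaling, so the
  price cancels against the next price change and the final value is the lag-one empirical
  covariance \<open>(X 1 * X 2 + \<dots> + X (N - 1) * X N) / N\<close> (\<open>strat_value_eq_lag_sum\<close>). This is a quadratic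
  form in the random signs, and the theorem is a weak law of large numbers for it.

  Mean. Write \<open>a = H - 1/2\<close>, which lies strictly between \<open>0\<close> and \<open>1/2\<close>. As the time \<open>n\<close> grows, the
  coefficient of \<open>\<xi> (n - m)\<close> in \<open>X n\<close> tends to \<open>2 * g_const * rho m\<close>, and that of \<open>\<xi> n\<close> tends to
  \<open>g_const\<close>. The limits need not be computed, since the coefficients are always at least that large
  (\<open>j_coef_bounds\<close>, \<open>g_coef_bounds\<close>): the quotient of powers that separates them from the stationary
  values is at least \<open>1\<close>. Hence the covariance of \<open>X n\<close> and \<open>X (n + 1)\<close> is bounded below by partial
  sums of \<open>theta\<close>, and so, after averaging, is the mean of the final value
  (\<open>lag_kernel_trace_eventually_ge\<close>). Only a one-sided estimate is claimed, so this suffices.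

  Variance. The coefficient of \<open>\<xi> i\<close> in \<open>X n\<close> is at most a constant times
  \<open>(n/i) powr a * (n - i + 1) powr (a - 1)\<close>. Consequently the variances of the \<open>X n\<close> are bounded
  (\<open>X_coef_square_sum_bounded\<close>), which also gives convergence of the series in \<open>theta\<close>, and the
  variance of \<open>X 1 + \<dots> + X N\<close> is of order at most \<open>N powr (2 * H)\<close> (\<open>X_coef_column_square_sum_le\<close>).
  The variance of a quadratic form in independent signs is at most twice the sum of its squared
  coefficients (\<open>random_sign_quadratic_form_variance\<close>). That sum is a sum over pairs of times of
  products of two covariances of the \<open>X n\<close>; bounding one of them by a constant and summing the other,
  which is nonnegative, gives the order \<open>N powr (2 * H)\<close> once more (\<open>lag_kernel_square_sum_le\<close>).
  After division by \<open>N\<^sup>2\<close> this tends to \<open>0\<close> as \<open>H < 1\<close>, and Chebyshev's inequality concludes.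
\<close>

section \<open>Increments and sums of powers\<close>

text \<open>
  Weighted AM-GM with weights \<open>b\<close> and \<open>1 - b\<close>, applied to \<open>x - 1\<close> and \<open>x\<close>, gives this
  after division by \<open>x powr (1 - b)\<close>.
\<close>

lemma powr_increment_ge:
  fixes x b :: real
  assumes "1 \<le> x" "0 < b" "b \<le> 1"
  shows "b * x powr (b - 1) \<le> x powr b - (x - 1) powr b"
proof (cases "x = 1")
  case True
  then show ?thesis using assms by simp
next
  case False
  then have x: "x > 1" using assms by simp
  have "(x - 1) powr b * x powr (1 - b) \<le> b * (x - 1) + (1 - b) * x"
    by (rule Youngs_inequality_0) (use x assms in auto)
  then have "(x - 1) powr b * x powr (1 - b) * x powr (b - 1) \<le> (x - b) * x powr (b - 1)"
    by (intro mult_right_mono) (auto simp: algebra_simps)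
  moreover have "x powr (1 - b) * x powr (b - 1) = 1"
    using x by (simp flip: powr_add)
  moreover have "x * x powr (b - 1) = x powr b"
    using x by (simp add: powr_diff)
  ultimately have "(x - 1) powr b \<le> x powr b - b * x powr (b - 1)"
    by (simp add: mult.assoc left_diff_distrib)
  then show ?thesis by simp
qed

text \<open>
  Since \<open>b \<le> 1\<close>, the number \<open>t = (x - 1)/x\<close> in \<open>[0, 1]\<close> satisfies \<open>t \<le> t powr b\<close>; multiply by \<open>x powr b\<close>.
\<close>

lemma powr_increment_le:
  fixes x b :: real
  assumes "1 \<le> x" "0 \<le> b" "b \<le> 1"
  shows "x powr b - (x - 1) powr b \<le> x powr (b - 1)"
proof -
  define t where "t = (x - 1) / x"
  have t: "0 \<le> t" "t \<le> 1" "x - 1 = x * t" using assms by (auto simp: t_def)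
  have "t \<le> t powr b"
  proof (cases "t = 0")
    case False
    then show ?thesis using t assms powr_mono'[of b 1 t] by simp
  qed simp
  then have "x powr b * t \<le> x powr b * t powr b" by (intro mult_left_mono) auto
  also have "\<dots> = (x - 1) powr b" using t assms by (simp add: powr_mult)
  finally have "x powr b * t \<le> (x - 1) powr b" .
  moreover have "x powr b * t = x powr b - x powr (b - 1)"
    using assms by (simp add: t_def powr_diff field_simps)
  ultimately show ?thesis by simp
qed

text \<open>
  The lower bound on the increments of \<open>x powr b\<close> telescopes.
\<close>

lemma sum_powr_le:
  fixes b :: real
  assumes "0 < b" "b \<le> 1"
  shows "(\<Sum>m = 1..n. real m powr (b - 1)) \<le> real n powr b / b"
proof (induction n)
  case (Suc n)
  have "b * real (Suc n) powr (b - 1) \<le> real (Suc n) powr b - real n powr b"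
    using powr_increment_ge[of "real (Suc n)" b] assms by simp
  then have "real (Suc n) powr (b - 1) \<le> (real (Suc n) powr b - real n powr b) / b"
    using assms by (simp add: pos_le_divide_eq mult.commute)
  with Suc show ?case by (simp add: diff_divide_distrib)
qed simp

section \<open>Sandwich bounds for weighted power integrals\<close>

text \<open>
  The primitive is differentiated only in the open interval, because the integrands
  \<open>(v + c) powr (a - 1)\<close> and \<open>x powr (- a)\<close> below may be singular at the left endpoint.
  Nonnegativity upgrades Henstock-Kurzweil to Lebesgue integrability.
\<close>

lemma FTC_nonneg:
  fixes F f :: "real \<Rightarrow> real"
  assumes "a \<le> b" "continuous_on {a..b} F"
    and "\<And>x. a < x \<Longrightarrow> x < b \<Longrightarrow> (F has_real_derivative f x) (at x)"
    and "\<And>x. a \<le> x \<Longrightarrow> x \<le> b \<Longrightarrow> 0 \<le> f x"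
    and [measurable]: "f \<in> borel_measurable borel"
  shows "set_integrable lborel {a..b} f" and "(LBINT x:{a..b}. f x) = F b - F a"
proof -
  have hi: "(f has_integral F b - F a) {a..b}"
    by (rule fundamental_theorem_of_calculus_interior)
      (use assms in \<open>auto simp: has_real_derivative_iff_has_vector_derivative\<close>)
  have "f absolutely_integrable_on {a..b}"
    by (rule nonnegative_absolutely_integrable_1) (use hi assms in auto)
  then show int: "set_integrable lborel {a..b} f"
    by (simp add: set_integrable_def integrable_completion)
  show "(LBINT x:{a..b}. f x) = F b - F a"
    using set_borel_integral_eq_integral(2)[OF int] hi by (simp add: integral_unique)
qed

text \<open>
  One point \<open>z\<close> may be ignored: at \<open>x = 0\<close> the convention \<open>0 powr a = 0\<close> would break the
  lower bound for \<open>x powr (- a)\<close>. Integrability of \<open>f\<close> is part of the conclusion, and it matters,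
  since the integral of a function that is not integrable is \<open>0\<close>.
\<close>

lemma integral_between:
  fixes f :: "real \<Rightarrow> real"
  assumes l: "set_integrable lborel S l" and u: "set_integrable lborel S u"
    and f[measurable]: "f \<in> borel_measurable borel" and [measurable]: "S \<in> sets borel"
    and le: "\<And>x. x \<in> S \<Longrightarrow> x \<noteq> z \<Longrightarrow> 0 \<le> l x \<and> l x \<le> f x \<and> f x \<le> u x"
  shows "set_integrable lborel S f"
    and "(LBINT x:S. l x) \<le> (LBINT x:S. f x)"
    and "(LBINT x:S. f x) \<le> (LBINT x:S. u x)"
proof -
  have ae: "AE x in lborel. x \<noteq> z" by (rule AE_lborel_singleton)
  show int: "set_integrable lborel S f"
    unfolding set_integrable_def
  proof (rule Bochner_Integration.integrable_bound)
    show "integrable lborel (\<lambda>x. indicator S x *\<^sub>R u x)" using u by (simp add: set_integrable_def)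
    show "AE x in lborel. norm (indicator S x *\<^sub>R f x) \<le> norm (indicator S x *\<^sub>R u x)"
      using ae by eventually_elim (use le in \<open>fastforce simp: indicator_def\<close>)
  qed simp
  show "(LBINT x:S. l x) \<le> (LBINT x:S. f x)"
    unfolding set_lebesgue_integral_def
    by (rule integral_mono_AE)
      (use l int ae le in \<open>auto simp: set_integrable_def indicator_def elim: eventually_mono\<close>)
  show "(LBINT x:S. f x) \<le> (LBINT x:S. u x)"
    unfolding set_lebesgue_integral_def
    by (rule integral_mono_AE)
      (use u int ae le in \<open>auto simp: set_integrable_def indicator_def elim: eventually_mono\<close>)
qed

text \<open>
  Both inner integrals have this form: a bounded weight \<open>w\<close> against the kernel
  \<open>(v + c) powr (a - 1)\<close>, whose integral is explicit. In \<open>j_coef\<close> the shift is \<open>c = n - 1 - x\<close>, in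
  \<open>g_coef\<close> it is \<open>c = 0\<close>.
\<close>

lemma inner_integral_bounds:
  fixes a c lo hi :: real
  assumes a: "0 < a" and c: "0 \<le> c"
    and [measurable]: "w \<in> borel_measurable borel"
    and w: "\<And>v. 0 \<le> v \<Longrightarrow> v \<le> 1 \<Longrightarrow> lo \<le> w v \<and> w v \<le> hi" and lo: "0 \<le> lo"
  shows "lo * (((1 + c) powr a - c powr a) / a) \<le> (LBINT v:{0..1}. w v * (v + c) powr (a - 1))"
    and "(LBINT v:{0..1}. w v * (v + c) powr (a - 1)) \<le> hi * (((1 + c) powr a - c powr a) / a)"
proof -
  define k where "k v = (v + c) powr (a - 1)" for v
  have [measurable]: "k \<in> borel_measurable borel" unfolding k_def by measurable
  have k0: "k v \<ge> 0" for v by (simp add: k_def)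
  have K: "set_integrable lborel {0..1} k"
    "(LBINT v:{0..1}. k v) = (1 + c) powr a / a - (0 + c) powr a / a"
  proof -
    have co: "continuous_on {0..1} (\<lambda>v. (v + c) powr a / a)"
      using a c by (intro continuous_on_divide continuous_on_powr') (auto intro!: continuous_intros)
    have de: "((\<lambda>v. (v + c) powr a / a) has_real_derivative k v) (at v)" if "0 < v" "v < 1" for v
      unfolding k_def using that a c by (auto intro!: derivative_eq_intros simp: field_simps)
    show "set_integrable lborel {0..1} k"
      "(LBINT v:{0..1}. k v) = (1 + c) powr a / a - (0 + c) powr a / a"
      using FTC_nonneg[OF _ co de] k0 by auto
  qed
  have 1: "(1 + c) powr a / a - (0 + c) powr a / a = ((1 + c) powr a - c powr a) / a"
    by (simp add: diff_divide_distrib)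
  have "0 \<le> lo * k v \<and> lo * k v \<le> w v * k v \<and> w v * k v \<le> hi * k v" if "v \<in> {0..1}" for v
    using w[of v] that lo k0[of v] by (auto intro!: mult_right_mono)
  note * = integral_between[where S="{0..1::real}" and f="\<lambda>v. w v * k v"
      and l="\<lambda>v. lo * k v" and u="\<lambda>v. hi * k v", OF _ _ _ _ this]
  show "lo * (((1 + c) powr a - c powr a) / a) \<le> (LBINT v:{0..1}. w v * (v + c) powr (a - 1))"
    using *(2) K unfolding 1 k_def[symmetric] by simp
  show "(LBINT v:{0..1}. w v * (v + c) powr (a - 1)) \<le> hi * (((1 + c) powr a - c powr a) / a)"
    using *(3) K unfolding 1 k_def[symmetric] by simp
qed

text \<open>
  The constant \<open>2\<close> bounds \<open>1/(1 - a)\<close>; the bound is uniform in \<open>i\<close>, including \<open>i = 1\<close> where the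
  integrand is unbounded.
\<close>

lemma powr_neg_integral:
  fixes a :: real
  assumes a: "0 < a" "a < 1/2" and i: "1 \<le> i"
  shows "set_integrable lborel {real i - 1..real i} (\<lambda>x. x powr (-a))"
    and "(LBINT x:{real i - 1..real i}. x powr (-a)) \<le> 2 * real i powr (-a)"
proof -
  define F where "F x = x powr (1 - a) / (1 - a)" for x :: real
  have co: "continuous_on {real i - 1..real i} F"
    unfolding F_def using a i by (intro continuous_on_divide continuous_on_powr') auto
  have de: "(F has_real_derivative x powr (-a)) (at x)" if "real i - 1 < x" "x < real i" for x
  proof -
    have "((\<lambda>x. x powr (1 - a)) has_real_derivative (1 - a) * x powr (1 - a - 1)) (at x)"
      by (rule has_real_derivative_powr) (use that i in auto)
    from DERIV_cdivide[OF this, of "1 - a"] show ?thesis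
      using a unfolding F_def by simp
  qed
  note * = FTC_nonneg[OF _ co de]
  show "set_integrable lborel {real i - 1..real i} (\<lambda>x. x powr (-a))"
    by (rule *(1)) auto
  have "(LBINT x:{real i - 1..real i}. x powr (-a)) = F i - F (real i - 1)"
    by (rule *(2)) auto
  also have "\<dots> = (real i powr (1 - a) - (real i - 1) powr (1 - a)) / (1 - a)"
    by (simp add: F_def diff_divide_distrib)
  also have "\<dots> \<le> real i powr (1 - a - 1) / (1 - a)"
    using powr_increment_le[of "real i" "1 - a"] a i by (intro divide_right_mono) auto
  also have "\<dots> = real i powr (- a) * (1 / (1 - a))" by simp
  also have "\<dots> \<le> real i powr (-a) * 2"
    using a by (intro mult_left_mono) (auto simp: field_simps)
  finally show "(LBINT x:{real i - 1..real i}. x powr (-a)) \<le> 2 * real i powr (-a)" by simp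
qed

text \<open>
  Both outer integrals have this form. In the lower bound the singular factor \<open>x powr (- a)\<close> is
  cancelled by the minimum \<open>x powr a\<close> of the weight in the inner integral; in the upper bound it is
  integrated on its own.
\<close>

lemma outer_integral_bounds:
  fixes a U :: real
  assumes a: "0 < a" "a < 1/2" and i: "1 \<le> i"
    and l: "set_integrable lborel {real i - 1..real i} l"
    and [measurable]: "G \<in> borel_measurable borel"
    and lG: "\<And>x. real i - 1 \<le> x \<Longrightarrow> x \<le> real i \<Longrightarrow> 0 < x \<Longrightarrow>
               0 \<le> l x \<and> x powr a * l x \<le> G x \<and> G x \<le> U"
    and U: "0 \<le> U"
  shows "(LBINT x:{real i - 1..real i}. l x) \<le> (LBINT x:{real i - 1..real i}. x powr (-a) * G x)"
    and "(LBINT x:{real i - 1..real i}. x powr (-a) * G x) \<le> 2 * U * real i powr (-a)"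
proof -
  have b: "0 \<le> l x \<and> l x \<le> x powr (-a) * G x \<and> x powr (-a) * G x \<le> U * x powr (-a)"
    if "x \<in> {real i - 1..real i}" "x \<noteq> 0" for x
  proof -
    have x: "x > 0" using that i by auto
    have "x powr (-a) * (x powr a * l x) \<le> x powr (-a) * G x"
      using lG[of x] x that by (intro mult_left_mono) auto
    moreover have "x powr (-a) * (x powr a * l x) = l x"
    proof -
      have "x powr (-a) * x powr a = 1" using x by (simp flip: powr_add)
      then show ?thesis by (simp add: mult.assoc[symmetric])
    qed
    moreover have "x powr (-a) * G x \<le> x powr (-a) * U"
      using lG[of x] x that by (intro mult_left_mono) auto
    ultimately show ?thesis using lG[of x] x that by (metis atLeastAtMost_iff mult.commute)
  qed
  have ui: "set_integrable lborel {real i - 1..real i} (\<lambda>x. U * x powr (-a))"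
    using powr_neg_integral(1)[OF a i] by simp
  note * = integral_between[OF l ui _ _ b]
  show "(LBINT x:{real i - 1..real i}. l x) \<le> (LBINT x:{real i - 1..real i}. x powr (-a) * G x)"
    by (rule *(2)) auto
  have "(LBINT x:{real i - 1..real i}. x powr (-a) * G x) \<le> (LBINT x:{real i - 1..real i}. U * x powr (-a))"
    by (rule *(3)) auto
  also have "\<dots> = U * (LBINT x:{real i - 1..real i}. x powr (-a))" by simp
  also have "\<dots> \<le> U * (2 * real i powr (-a))"
    using powr_neg_integral(2)[OF a i] U by (intro mult_left_mono) auto
  finally show "(LBINT x:{real i - 1..real i}. x powr (-a) * G x) \<le> 2 * U * real i powr (-a)" by simp
qed


section \<open>The coefficients of the increments\<close>

definition X_coef :: "real \<Rightarrow> real \<Rightarrow> nat \<Rightarrow> nat \<Rightarrow> real" where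
  "X_coef H \<sigma> n i = (if i < n then j_coef H \<sigma> n i else if i = n then g_coef H \<sigma> n else 0)"

lemma X_proc_eq_sum:
  assumes "1 \<le> n" "n \<le> N"
  shows "X_proc H \<sigma> \<xi> n \<omega> = (\<Sum>i = 1..N. X_coef H \<sigma> n i * \<xi> i \<omega>)"
proof -
  have "(\<Sum>i = 1..N. X_coef H \<sigma> n i * \<xi> i \<omega>) = (\<Sum>i \<in> insert n {1..n - 1}. X_coef H \<sigma> n i * \<xi> i \<omega>)"
    by (rule sum.mono_neutral_right) (use assms in \<open>auto simp: X_coef_def\<close>)
  also have "\<dots> = X_coef H \<sigma> n n * \<xi> n \<omega> + (\<Sum>i = 1..n - 1. X_coef H \<sigma> n i * \<xi> i \<omega>)"
    using assms by (subst sum.insert) auto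
  also have "(\<Sum>i = 1..n - 1. X_coef H \<sigma> n i * \<xi> i \<omega>) = Y_proc H \<sigma> \<xi> n \<omega>"
    unfolding Y_proc_def by (rule sum.cong) (auto simp: X_coef_def)
  finally show ?thesis by (simp add: X_proc_def X_coef_def)
qed

lemma c_const_pos: "1/2 < H \<Longrightarrow> H < 1 \<Longrightarrow> 0 < c_const H"
  by (auto simp: c_const_def intro!: divide_pos_pos mult_pos_pos Gamma_real_pos)

lemma g_const_pos: "1/2 < H \<Longrightarrow> H < 1 \<Longrightarrow> 0 < \<sigma> \<Longrightarrow> 0 < g_const H \<sigma>"
  by (auto simp: g_const_def intro!: divide_pos_pos mult_pos_pos c_const_pos)

lemma g_const_eq_C_const:
  assumes "1/2 < H"
  shows "g_const H \<sigma> = \<sigma> * C_const H * (1 / ((H - 1/2) * (H + 1/2)))"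
  using assms by (simp add: g_const_def C_const_def)

text \<open>
  The integrand is \<open>LBINT v:{0..1}. (v + n - 1 - x) powr (H - 3/2)\<close>, that is the kernel of \<open>j_coef\<close> with the
  product of its slowly varying factors replaced by \<open>1\<close>. Integrating twice turns the kernel into the
  second difference of the power \<open>H + 1/2\<close>, which is \<open>2 * rho\<close>, up to a constant.
\<close>

lemma rho_integral:
  fixes m i n :: nat
  assumes H: "1/2 < H" "H < 1" and i: "1 \<le> i" and m: "1 \<le> m" and n: "n = m + i"
  defines "l \<equiv> \<lambda>x. ((real n - x) powr (H - 1/2) - (real n - 1 - x) powr (H - 1/2)) / (H - 1/2)"
  shows "set_integrable lborel {real i - 1..real i} l"
    and "(LBINT x:{real i - 1..real i}. l x) = 2 * rho H m / ((H - 1/2) * (H + 1/2))"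
proof -
  define a where "a = H - 1/2"
  have a: "0 < a" "a < 1/2" using H by (auto simp: a_def)
  define F where "F x = ((real n - 1 - x) powr (a + 1) - (real n - x) powr (a + 1)) / (a * (a + 1))" for x
  have co: "continuous_on {real i - 1..real i} F"
    unfolding F_def using a m n
    by (intro continuous_on_divide continuous_on_diff continuous_on_powr')
      (auto intro!: continuous_intros)
  have de: "(F has_real_derivative l x) (at x)" if x: "real i - 1 < x" "x < real i" for x
  proof -
    have "((\<lambda>x. (real n - 1 - x) powr (a + 1) - (real n - x) powr (a + 1)) has_real_derivative
            (a + 1) * (real n - x) powr a - (a + 1) * (real n - 1 - x) powr a) (at x)"
      using x m n by (auto intro!: derivative_eq_intros)
    from DERIV_cdivide[OF this, of "a * (a + 1)"]
    have "(F has_real_derivative ((a + 1) * ((real n - x) powr a - (real n - 1 - x) powr a)) / ((a + 1) * a)) (at x)"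
      unfolding F_def by (simp add: right_diff_distrib mult.commute)
    then show ?thesis using a unfolding l_def a_def[symmetric] by simp
  qed
  have nn: "0 \<le> l x" if "real i - 1 \<le> x" "x \<le> real i" for x
    using a that m n unfolding l_def a_def[symmetric] by (auto intro!: divide_nonneg_pos powr_mono2)
  have me: "l \<in> borel_measurable borel" unfolding l_def by measurable
  show "set_integrable lborel {real i - 1..real i} l"
    by (rule FTC_nonneg(1)[OF _ co de nn me]) auto
  have "(LBINT x:{real i - 1..real i}. l x) = F i - F (real i - 1)"
    by (rule FTC_nonneg(2)[OF _ co de nn me]) auto
  also have "\<dots> = 2 * rho H m / (a * (a + 1))"
  proof -
    have "2 * h_exp H = a + 1" by (simp add: h_exp_def a_def)
    then show ?thesis using n unfolding F_def rho_def diff_divide_distrib[symmetric]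
      by (simp add: algebra_simps)
  qed
  finally show "(LBINT x:{real i - 1..real i}. l x) = 2 * rho H m / ((H - 1/2) * (H + 1/2))"
    by (simp add: a_def)
qed

lemma rho_nonneg:
  assumes H: "1/2 < H" "H < 1" and m: "1 \<le> m"
  shows "0 \<le> rho H m"
proof -
  have "0 \<le> (LBINT x:{real 1 - 1..real 1}. ((real (m + 1) - x) powr (H - 1/2) - (real (m + 1) - 1 - x) powr (H - 1/2)) / (H - 1/2))"
    unfolding set_lebesgue_integral_def
    by (rule integral_nonneg_AE) (use H m in \<open>auto simp: indicator_def intro!: divide_nonneg_pos powr_mono2 AE_I2\<close>)
  then have "0 \<le> 2 * rho H m / ((H - 1/2) * (H + 1/2))"
    using rho_integral(2)[OF H _ m, of 1 "m + 1"] by simp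
  moreover have "0 < (H - 1/2) * (H + 1/2)" using H by (intro mult_pos_pos) auto
  ultimately show ?thesis by (simp add: zero_le_divide_iff not_le[symmetric] del: not_le)
qed

text \<open>
  The quotient of \<open>(v + n - 1) powr (H - 1/2)\<close> by \<open>x powr (H - 1/2)\<close> is at least \<open>1\<close>, because
  \<open>x \<le> i \<le> n - 1\<close>; so \<open>j_coef\<close> is at least its stationary limit \<open>2 * g_const * rho (n - i)\<close>. In the upper
  bound the shift by \<open>1\<close> in \<open>n - i + 1\<close> makes the right side meaningful for \<open>i = n\<close> as well, so that
  all coefficients obey one formula.
\<close>

lemma j_coef_bounds:
  fixes H \<sigma> :: real
  assumes H: "1/2 < H" "H < 1" and s: "0 < \<sigma>" and i: "1 \<le> i" "i < n"
  shows "2 * g_const H \<sigma> * rho H (n - i) \<le> j_coef H \<sigma> n i"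
    and "j_coef H \<sigma> n i \<le> 4 * \<sigma> * c_const H *
           (real n powr (H - 1/2) * real i powr (1/2 - H) * (real n - real i + 1) powr (H - 3/2))"
proof -
  define a where "a = H - 1/2"
  have a: "0 < a" "a < 1/2" using H by (auto simp: a_def)
  define m where "m = n - i"
  have m: "1 \<le> m" "n = m + i" "real n = real m + real i" using i by (auto simp: m_def)
  define l where "l = (\<lambda>x. ((real n - x) powr a - (real n - 1 - x) powr a) / a)"
  define G where "G = (\<lambda>x. LBINT v:{0..1}. (v + real n - 1) powr a * (v + real n - 1 - x) powr (a - 1))"
  define U where "U = real n powr a * (2 * (real n - real i + 1) powr (a - 1)) / a"
  have [measurable]: "G \<in> borel_measurable borel"
    unfolding G_def set_lebesgue_integral_def by measurable
  have C: "0 < \<sigma> * C_const H" using H s c_const_pos[of H] by (simp add: C_const_def)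
  have U: "0 \<le> U" using a by (simp add: U_def)
  have bounds: "0 \<le> l x \<and> x powr a * l x \<le> G x \<and> G x \<le> U"
    if x: "real i - 1 \<le> x" "x \<le> real i" "0 < x" for x
  proof -
    have c: "0 \<le> real n - 1 - x" using x m by simp
    have w: "x powr a \<le> (v + real n - 1) powr a \<and> (v + real n - 1) powr a \<le> real n powr a"
      if "0 \<le> v" "v \<le> 1" for v
      using x m that a by (auto intro!: powr_mono2)
    have me: "(\<lambda>v. (v + real n - 1) powr a) \<in> borel_measurable borel" by measurable
    note I = inner_integral_bounds[OF a(1) c me w]
    have eq: "(LBINT v:{0..1}. (v + real n - 1) powr a * (v + (real n - 1 - x)) powr (a - 1)) = G x"
      by (simp add: G_def algebra_simps)
    have eq2: "1 + (real n - 1 - x) = real n - x" by simp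
    have "0 \<le> l x" using x m a by (auto simp: l_def intro!: divide_nonneg_pos powr_mono2)
    moreover have "x powr a * l x \<le> G x"
      using I(1) unfolding eq eq2 l_def by simp
    moreover have "G x \<le> U"
    proof -
      have "G x \<le> real n powr a * (((real n - x) powr a - (real n - 1 - x) powr a) / a)"
        using I(2) unfolding eq eq2 by simp
      also have "(real n - x) powr a - (real n - 1 - x) powr a \<le> (real n - x) powr (a - 1)"
        using powr_increment_le[of "real n - x" a] x m a by (simp add: algebra_simps)
      also have "\<dots> \<le> real m powr (a - 1)"
        using x m a by (intro powr_mono2') auto
      also have "\<dots> \<le> 2 * (real m + 1) powr (a - 1)"
      proof -
        have "(1/2) * real m powr (a - 1) \<le> 2 powr (a - 1) * real m powr (a - 1)"
          using powr_mono[of "-1" "a - 1" 2] a by (intro mult_right_mono) (auto simp: powr_minus)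
        also have "\<dots> = (2 * real m) powr (a - 1)" by (simp add: powr_mult)
        also have "\<dots> \<le> (real m + 1) powr (a - 1)"
          using m a by (intro powr_mono2') auto
        finally show ?thesis by simp
      qed
      finally show ?thesis using a m by (simp add: U_def divide_right_mono mult_left_mono)
    qed
    ultimately show ?thesis by blast
  qed
  have li: "set_integrable lborel {real i - 1..real i} l"
    and lv: "(LBINT x:{real i - 1..real i}. l x) = 2 * rho H m / ((H - 1/2) * (H + 1/2))"
    using rho_integral[OF H i(1) m(1) m(2)] unfolding l_def a_def by auto
  have j: "j_coef H \<sigma> n i = \<sigma> * C_const H * (LBINT x:{real i - 1..real i}. x powr (-a) * G x)"
    by (simp add: j_coef_def G_def a_def)
  note * = outer_integral_bounds[OF a i(1) li _ bounds U]
  have "2 * g_const H \<sigma> * rho H m = \<sigma> * C_const H * (LBINT x:{real i - 1..real i}. l x)"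
    using H by (simp add: lv g_const_eq_C_const)
  also have "\<dots> \<le> j_coef H \<sigma> n i"
    unfolding j using *(1) C by (intro mult_left_mono) auto
  finally show "2 * g_const H \<sigma> * rho H (n - i) \<le> j_coef H \<sigma> n i" by (simp add: m_def)
  have "j_coef H \<sigma> n i \<le> \<sigma> * C_const H * (2 * U * real i powr (-a))"
    unfolding j using *(2) C by (intro mult_left_mono) auto
  also have "\<dots> = 4 * \<sigma> * c_const H *
           (real n powr a * real i powr (-a) * (real n - real i + 1) powr (a - 1))"
    using a unfolding C_const_def a_def[symmetric] by (simp add: U_def)
  finally show "j_coef H \<sigma> n i \<le> 4 * \<sigma> * c_const H *
           (real n powr (H - 1/2) * real i powr (1/2 - H) * (real n - real i + 1) powr (H - 3/2))"
    by (simp add: a_def)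
qed

text \<open>
  The same comparison, now with \<open>x \<le> y (n - x) + x \<le> n\<close>; the lower bound is again the limiting
  value.
\<close>

lemma g_coef_bounds:
  fixes H \<sigma> :: real
  assumes H: "1/2 < H" "H < 1" and s: "0 < \<sigma>" and n: "1 \<le> n"
  shows "g_const H \<sigma> \<le> g_coef H \<sigma> n" and "g_coef H \<sigma> n \<le> 2 * \<sigma> * c_const H"
proof -
  define a where "a = H - 1/2"
  have a: "0 < a" "a < 1/2" using H by (auto simp: a_def)
  define l where "l = (\<lambda>x. (real n - x) powr a / a)"
  define I where "I x = (LBINT y:{0..1}. (y * (real n - x) + x) powr a * y powr (a - 1))" for x
  define G where "G = (\<lambda>x. (real n - x) powr a * I x)"
  define U where "U = real n powr a / a"
  have [measurable]: "G \<in> borel_measurable borel"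
    unfolding G_def I_def set_lebesgue_integral_def by measurable
  have C: "0 < \<sigma> * C_const H" using H s c_const_pos[of H] by (simp add: C_const_def)
  have U: "0 \<le> U" using a by (simp add: U_def)
  have bounds: "0 \<le> l x \<and> x powr a * l x \<le> G x \<and> G x \<le> U"
    if x: "real n - 1 \<le> x" "x \<le> real n" "0 < x" for x
  proof -
    have w: "x powr a \<le> (y * (real n - x) + x) powr a \<and> (y * (real n - x) + x) powr a \<le> real n powr a"
      if "0 \<le> y" "y \<le> 1" for y
    proof -
      have "y * (real n - x) \<le> 1 * (real n - x)" using x that by (intro mult_right_mono) auto
      then show ?thesis using x that a by (auto intro!: powr_mono2)
    qed
    have me: "(\<lambda>y. (y * (real n - x) + x) powr a) \<in> borel_measurable borel" by measurable
    note I = inner_integral_bounds[OF a(1) order_refl me w]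
    have lo: "x powr a * (1 / a) \<le> I x" and hi: "I x \<le> real n powr a * (1 / a)"
      using I a by (auto simp: I_def)
    have p: "(real n - x) powr a \<le> 1" using x a powr_mono2[of a "real n - x" 1] by simp
    have "x powr a * l x = (real n - x) powr a * (x powr a * (1 / a))" by (simp add: l_def)
    also have "\<dots> \<le> G x" unfolding G_def by (intro mult_left_mono lo) auto
    finally have "x powr a * l x \<le> G x" .
    moreover have "G x \<le> 1 * (real n powr a * (1 / a))"
      unfolding G_def using a by (intro mult_mono p hi order_trans[OF _ lo]) auto
    ultimately show ?thesis using a by (simp add: l_def U_def)
  qed
  define F where "F x = - ((real n - x) powr (a + 1)) / (a * (a + 1))" for x
  have co: "continuous_on {real n - 1..real n} F"
    unfolding F_def using a
    by (intro continuous_on_divide continuous_on_minus continuous_on_powr')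
      (auto intro!: continuous_intros)
  have de: "(F has_real_derivative l x) (at x)" if x: "real n - 1 < x" "x < real n" for x
  proof -
    have "((\<lambda>x. - ((real n - x) powr (a + 1))) has_real_derivative (a + 1) * (real n - x) powr a) (at x)"
      using x by (auto intro!: derivative_eq_intros)
    from DERIV_cdivide[OF this, of "a * (a + 1)"]
    have "(F has_real_derivative ((a + 1) * (real n - x) powr a) / ((a + 1) * a)) (at x)"
      unfolding F_def by (simp add: mult.commute)
    then show ?thesis using a unfolding l_def by simp
  qed
  have nn: "0 \<le> l x" for x using a by (simp add: l_def)
  have me: "l \<in> borel_measurable borel" unfolding l_def by measurable
  have li: "set_integrable lborel {real n - 1..real n} l"
    by (rule FTC_nonneg(1)[OF _ co de nn me]) auto
  have "(LBINT x:{real n - 1..real n}. l x) = F n - F (real n - 1)"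
    by (rule FTC_nonneg(2)[OF _ co de nn me]) auto
  then have lv: "(LBINT x:{real n - 1..real n}. l x) = 1 / (a * (a + 1))"
    by (simp add: F_def)
  have g: "g_coef H \<sigma> n = \<sigma> * C_const H * (LBINT x:{real n - 1..real n}. x powr (-a) * G x)"
    by (simp add: g_coef_def G_def I_def a_def mult.assoc)
  note * = outer_integral_bounds[OF a n li _ bounds U]
  have "g_const H \<sigma> = \<sigma> * C_const H * (LBINT x:{real n - 1..real n}. l x)"
    using H by (simp add: lv g_const_eq_C_const a_def)
  also have "\<dots> \<le> g_coef H \<sigma> n"
    unfolding g using *(1) C by (intro mult_left_mono) auto
  finally show "g_const H \<sigma> \<le> g_coef H \<sigma> n" .
  have "g_coef H \<sigma> n \<le> \<sigma> * C_const H * (2 * U * real n powr (-a))"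
    unfolding g using *(2) C by (intro mult_left_mono) auto
  also have "\<dots> = 2 * \<sigma> * c_const H * (real n powr a * real n powr (-a))"
    using a unfolding C_const_def a_def[symmetric] by (simp add: U_def)
  also have "real n powr a * real n powr (-a) = 1" using n by (simp flip: powr_add)
  finally show "g_coef H \<sigma> n \<le> 2 * \<sigma> * c_const H" by simp
qed

lemma X_coef_nonneg:
  assumes "1/2 < H" "H < 1" "0 < \<sigma>" "1 \<le> i" "1 \<le> n"
  shows "0 \<le> X_coef H \<sigma> n i"
proof -
  consider "i < n" | "i = n" | "i > n" by linarith
  then show ?thesis
  proof cases
    case 1
    have "0 \<le> 2 * g_const H \<sigma> * rho H (n - i)"
      using 1 assms g_const_pos[of H \<sigma>] rho_nonneg[of H "n - i"] by simp
    also have "\<dots> \<le> j_coef H \<sigma> n i" by (rule j_coef_bounds) (use 1 assms in auto)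
    finally show ?thesis using 1 by (simp add: X_coef_def)
  next
    case 2
    then show ?thesis using assms g_coef_bounds(1)[of H \<sigma> n] g_const_pos[of H \<sigma>] by (simp add: X_coef_def)
  qed (simp add: X_coef_def)
qed

lemma X_coef_upper:
  assumes H: "1/2 < H" "H < 1" and "0 < \<sigma>" "1 \<le> i" "i \<le> n"
  shows "X_coef H \<sigma> n i \<le> 4 * \<sigma> * c_const H *
           (real n powr (H - 1/2) * real i powr (1/2 - H) * (real n - real i + 1) powr (H - 3/2))"
proof (cases "i = n")
  case True
  have "real n powr (H - 1/2) * real n powr (1/2 - H) = 1" using assms by (simp flip: powr_add)
  moreover have "g_coef H \<sigma> n \<le> 2 * \<sigma> * c_const H" by (rule g_coef_bounds) (use assms True in auto)
  moreover have "0 < \<sigma> * c_const H" using c_const_pos[OF H] assms by simp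
  ultimately show ?thesis using True by (simp add: X_coef_def)
next
  case False
  then show ?thesis using assms j_coef_bounds(2)[of H \<sigma> i n] by (simp add: X_coef_def)
qed


section \<open>Row and column sums of the coefficients\<close>

text \<open>
  Squared, the general bound reads \<open>(n/i) powr (2a) * m powr (2a - 2)\<close> with \<open>a = H - 1/2 < 1/2\<close> and
  \<open>m = n + 1 - i\<close>. The larger of \<open>i\<close> and \<open>m\<close> is at least \<open>n/2\<close>. If it is \<open>i\<close>, the first factor is at
  most \<open>2\<close>; if it is \<open>m\<close>, trade \<open>n\<close> for \<open>2 m\<close> and then use \<open>m powr (4a - 2) \<le> i powr (4a - 2)\<close>.
\<close>

lemma X_coef_square_le:
  fixes H \<sigma> :: real
  assumes H: "1/2 < H" "H < 1" and s: "0 < \<sigma>" and i: "1 \<le> i" "i \<le> n"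
  shows "(X_coef H \<sigma> n i)\<^sup>2 \<le>
           2 * (4 * \<sigma> * c_const H)\<^sup>2 * (real i powr (2 * H - 3) + real (n + 1 - i) powr (2 * H - 3))"
proof -
  define a where "a = H - 1/2"
  have a: "0 < a" "a < 1/2" using H by (auto simp: a_def)
  define K where "K = 4 * \<sigma> * c_const H"
  define m where "m = n + 1 - i"
  have m: "1 \<le> m" "real n - real i + 1 = real m" "real n = real m + real i - 1" using i by (auto simp: m_def)
  have "(X_coef H \<sigma> n i)\<^sup>2 \<le> (K * (real n powr a * real i powr (-a) * real m powr (a - 1)))\<^sup>2"
    using X_coef_upper[OF H s i] X_coef_nonneg[OF H s, of i n] i m
    by (intro power_mono) (simp_all add: K_def a_def)
  also have "\<dots> = K\<^sup>2 * (real n powr (2 * a) * real i powr (-2 * a) * real m powr (2 * a - 2))"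
  proof -
    have "(real n powr a)\<^sup>2 = real n powr (2 * a)" "(real i powr (-a))\<^sup>2 = real i powr (-2 * a)"
      "(real m powr (a - 1))\<^sup>2 = real m powr (2 * a - 2)"
      by (simp_all add: power2_eq_square flip: powr_add)
    then show ?thesis by (simp add: power_mult_distrib)
  qed
  also have "real n powr (2 * a) * real i powr (-2 * a) * real m powr (2 * a - 2)
               \<le> 2 * (real i powr (2 * a - 2) + real m powr (2 * a - 2))"
  proof (cases "m \<le> i")
    case True
    have "real n powr (2 * a) \<le> (2 * real i) powr (2 * a)"
      using True m a by (intro powr_mono2) auto
    also have "\<dots> = 2 powr (2 * a) * real i powr (2 * a)" by (simp add: powr_mult)
    also have "\<dots> \<le> 2 * real i powr (2 * a)"
      using a powr_mono[of "2 * a" 1 2] by (intro mult_right_mono) auto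
    finally have "real n powr (2 * a) * real i powr (-2 * a) * real m powr (2 * a - 2)
        \<le> 2 * real i powr (2 * a) * real i powr (-2 * a) * real m powr (2 * a - 2)"
      by (intro mult_right_mono) auto
    also have "\<dots> = 2 * (real i powr (2 * a) * real i powr (-2 * a)) * real m powr (2 * a - 2)"
      by (simp only: mult.assoc)
    also have "real i powr (2 * a) * real i powr (-2 * a) = 1" using i by (simp flip: powr_add)
    finally show ?thesis using powr_ge_zero[of "real i" "2 * a - 2"] unfolding distrib_left by linarith
  next
    case False
    have "real n powr (2 * a) \<le> (2 * real m) powr (2 * a)"
      using False m a by (intro powr_mono2) auto
    also have "\<dots> = 2 powr (2 * a) * real m powr (2 * a)" by (simp add: powr_mult)
    also have "\<dots> \<le> 2 * real m powr (2 * a)"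
      using a powr_mono[of "2 * a" 1 2] by (intro mult_right_mono) auto
    finally have "real n powr (2 * a) * real i powr (-2 * a) * real m powr (2 * a - 2)
        \<le> 2 * real m powr (2 * a) * real i powr (-2 * a) * real m powr (2 * a - 2)"
      by (intro mult_right_mono) auto
    also have "\<dots> = 2 * real i powr (-2 * a) * (real m powr (2 * a) * real m powr (2 * a - 2))"
      by (simp only: mult_ac)
    also have "real m powr (2 * a) * real m powr (2 * a - 2) = real m powr (4 * a - 2)"
      by (simp flip: powr_add)
    also have "real m powr (4 * a - 2) \<le> real i powr (4 * a - 2)"
      using False i a by (intro powr_mono2') auto
    also have "2 * real i powr (-2 * a) * real i powr (4 * a - 2) = 2 * real i powr (2 * a - 2)"
      by (simp add: mult.assoc flip: powr_add)
    finally have "real n powr (2 * a) * real i powr (-2 * a) * real m powr (2 * a - 2)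
        \<le> 2 * real i powr (2 * a - 2)" by (simp add: mult_left_mono)
    then show ?thesis using powr_ge_zero[of "real m" "2 * a - 2"]
      unfolding distrib_left by linarith
  qed
  finally have "(X_coef H \<sigma> n i)\<^sup>2
      \<le> K\<^sup>2 * (2 * (real i powr (2 * a - 2) + real m powr (2 * a - 2)))"
    by (simp add: mult_left_mono)
  moreover have e: "2 * a - 2 = 2 * H - 3" by (simp add: a_def)
  ultimately show ?thesis unfolding e K_def[symmetric] m_def by (simp add: distrib_left mult_ac)
qed

text \<open>
  The exponent \<open>2 H - 3\<close> is smaller than \<open>-1\<close>, so both power sums are bounded by one
  convergent series. The sum is the variance of the increment \<open>X n\<close>.
\<close>

lemma X_coef_square_sum_bounded:
  fixes H \<sigma> :: real
  assumes H: "1/2 < H" "H < 1" and s: "0 < \<sigma>"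
  obtains K where "0 < K" and "\<And>n N. (\<Sum>i = 1..N. (X_coef H \<sigma> n i)\<^sup>2) \<le> K"
proof -
  define p where "p k = real k powr (2 * H - 3)" for k
  define C where "C = 2 * (4 * \<sigma> * c_const H)\<^sup>2"
  have C: "0 \<le> C" by (simp add: C_def)
  have sp: "summable p" unfolding p_def using H by (subst summable_real_powr_iff) auto
  have p0: "0 \<le> p k" for k by (simp add: p_def)
  have le: "(\<Sum>i = 1..N. (X_coef H \<sigma> n i)\<^sup>2) \<le> 2 * C * suminf p + 1" for n N
  proof -
    have "(\<Sum>i = 1..N. (X_coef H \<sigma> n i)\<^sup>2) = (\<Sum>i \<in> {1..N} \<inter> {1..n}. (X_coef H \<sigma> n i)\<^sup>2)"
      by (rule sum.mono_neutral_right) (auto simp: X_coef_def)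
    also have "\<dots> \<le> (\<Sum>i = 1..n. (X_coef H \<sigma> n i)\<^sup>2)"
      by (rule sum_mono2) auto
    also have "\<dots> \<le> (\<Sum>i = 1..n. C * (p i + p (n + 1 - i)))"
      unfolding p_def C_def by (intro sum_mono X_coef_square_le H s) auto
    also have "\<dots> = C * ((\<Sum>i = 1..n. p i) + (\<Sum>i = 1..n. p (n + 1 - i)))"
      by (simp add: sum_distrib_left sum.distrib distrib_left)
    also have "(\<Sum>i = 1..n. p (n + 1 - i)) = (\<Sum>i = 1..n. p i)"
      by (rule sum.reindex_bij_witness[of _ "\<lambda>i. n + 1 - i" "\<lambda>i. n + 1 - i"]) auto
    also have "(\<Sum>i = 1..n. p i) \<le> suminf p"
      by (rule sum_le_suminf[OF sp]) (auto simp: p0)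
    finally show ?thesis using C by (simp add: mult_left_mono)
  qed
  have "0 \<le> suminf p" by (rule suminf_nonneg[OF sp]) (rule p0)
  then show ?thesis using that[OF _ le] C by (simp add: add_nonneg_pos)
qed

text \<open>
  The left side is the coefficient of \<open>\<xi> i\<close> in \<open>X 1 + \<dots> + X N\<close>. Replacing \<open>n powr (H - 1/2)\<close> by its value
  at \<open>N\<close> in the bound for the single coefficients leaves a power sum in \<open>n - i + 1\<close>.
\<close>

lemma X_coef_column_sum_le:
  fixes H \<sigma> :: real
  assumes H: "1/2 < H" "H < 1" and s: "0 < \<sigma>" and i: "1 \<le> i" "i \<le> N"
  shows "(\<Sum>n = 1..N. X_coef H \<sigma> n i) \<le>
           4 * \<sigma> * c_const H / (H - 1/2) * real N powr (2 * H - 1) * real i powr (1/2 - H)"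
proof -
  define a where "a = H - 1/2"
  have a: "0 < a" "a < 1/2" using H by (auto simp: a_def)
  define K where "K = 4 * \<sigma> * c_const H"
  have K: "0 < K" using s c_const_pos[OF H] by (simp add: K_def)
  have "(\<Sum>n = 1..N. X_coef H \<sigma> n i) = (\<Sum>n = i..N. X_coef H \<sigma> n i)"
    by (rule sum.mono_neutral_right) (use i in \<open>auto simp: X_coef_def\<close>)
  also have "\<dots> \<le> (\<Sum>n = i..N. K * real N powr a * real i powr (-a) * real (n - i + 1) powr (a - 1))"
  proof (rule sum_mono)
    fix n assume n: "n \<in> {i..N}"
    have "X_coef H \<sigma> n i \<le> K * (real n powr a * real i powr (-a) * real (n - i + 1) powr (a - 1))"
      using X_coef_upper[OF H s i(1), of n] n by (simp add: K_def a_def of_nat_diff add.commute)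
    also have "\<dots> \<le> K * (real N powr a * real i powr (-a) * real (n - i + 1) powr (a - 1))"
      using K n a by (intro mult_left_mono mult_right_mono powr_mono2) auto
    finally show "X_coef H \<sigma> n i \<le> K * real N powr a * real i powr (-a) * real (n - i + 1) powr (a - 1)"
      by (simp add: mult.assoc)
  qed
  also have "\<dots> = K * real N powr a * real i powr (-a) * (\<Sum>n = i..N. real (n - i + 1) powr (a - 1))"
    by (simp add: sum_distrib_left)
  also have "(\<Sum>n = i..N. real (n - i + 1) powr (a - 1)) = (\<Sum>m = 1..N - i + 1. real m powr (a - 1))"
    by (rule sum.reindex_bij_witness[of _ "\<lambda>m. m + i - 1" "\<lambda>n. n - i + 1"]) (use i in auto)
  also have "\<dots> \<le> (\<Sum>m = 1..N. real m powr (a - 1))"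
    by (rule sum_mono2) (use i in auto)
  also have "\<dots> \<le> real N powr a / a"
    by (rule sum_powr_le) (use a in auto)
  finally have "(\<Sum>n = 1..N. X_coef H \<sigma> n i)
      \<le> K * real N powr a * real i powr (-a) * (real N powr a / a)"
    using K by (simp add: mult_left_mono)
  also have "\<dots> = K / a * (real N powr a * real N powr a) * real i powr (-a)" by simp
  also have "real N powr a * real N powr a = real N powr (2 * H - 1)"
    by (simp add: a_def flip: powr_add)
  finally show ?thesis by (simp add: K_def a_def)
qed

text \<open>
  The left side is the variance of \<open>X 1 + \<dots> + X N\<close>. Its growth is at most that of the self-similar
  scaling \<open>N powr (2 H)\<close>, which is \<open>o(N\<^sup>2)\<close>.
\<close>

lemma X_coef_column_square_sum_le:
  fixes H \<sigma> :: real
  assumes H: "1/2 < H" "H < 1" and s: "0 < \<sigma>"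
  shows "(\<Sum>i = 1..N. (\<Sum>n = 1..N. X_coef H \<sigma> n i)\<^sup>2) \<le>
           (4 * \<sigma> * c_const H / (H - 1/2))\<^sup>2 / (2 - 2 * H) * real N powr (2 * H)"
proof -
  define C where "C = 4 * \<sigma> * c_const H / (H - 1/2)"
  have "(\<Sum>i = 1..N. (\<Sum>n = 1..N. X_coef H \<sigma> n i)\<^sup>2)
      \<le> (\<Sum>i = 1..N. (C * real N powr (2 * H - 1) * real i powr (1/2 - H))\<^sup>2)"
    unfolding C_def
    by (intro sum_mono power_mono X_coef_column_sum_le sum_nonneg X_coef_nonneg) (use H s in auto)
  also have "\<dots> = (\<Sum>i = 1..N. C\<^sup>2 * real N powr (4 * H - 2) * real i powr (1 - 2 * H))"
  proof (intro sum.cong refl)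
    have sq: "(x powr b)\<^sup>2 = x powr (2 * b)" for x b :: real
      by (simp add: power2_eq_square flip: powr_add)
    show "(C * real N powr (2 * H - 1) * real i powr (1/2 - H))\<^sup>2 =
            C\<^sup>2 * real N powr (4 * H - 2) * real i powr (1 - 2 * H)" for i
      by (simp add: power_mult_distrib sq)
  qed
  also have "\<dots> = C\<^sup>2 * real N powr (4 * H - 2) * (\<Sum>i = 1..N. real i powr (2 - 2 * H - 1))"
    by (simp add: sum_distrib_left)
  also have "\<dots> \<le> C\<^sup>2 * real N powr (4 * H - 2) * (real N powr (2 - 2 * H) / (2 - 2 * H))"
    by (intro mult_left_mono sum_powr_le) (use H in auto)
  also have "\<dots> = C\<^sup>2 / (2 - 2 * H) * (real N powr (4 * H - 2) * real N powr (2 - 2 * H))"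
    by simp
  also have "real N powr (4 * H - 2) * real N powr (2 - 2 * H) = real N powr (2 * H)"
    by (simp flip: powr_add)
  finally show ?thesis by (simp add: C_def)
qed

text \<open>
  Expanding the square gives a sum over pairs \<open>n, m\<close> of products of two Gram entries, one of \<open>u\<close> and
  one of \<open>v\<close>. The Gram entries of \<open>u\<close> are at most \<open>K\<close> by the AM-GM inequality, and those of \<open>v\<close> are
  nonnegative, so \<open>K\<close> can be pulled out; what remains is the Gram sum of \<open>v\<close>.
\<close>

lemma sum_square_product_kernel_le:
  fixes u v :: "'n \<Rightarrow> 'i \<Rightarrow> real"
  assumes u: "\<And>n. n \<in> T \<Longrightarrow> (\<Sum>i\<in>I. (u n i)\<^sup>2) \<le> K"
    and v: "\<And>n i. n \<in> T \<Longrightarrow> i \<in> I \<Longrightarrow> 0 \<le> v n i"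
  shows "(\<Sum>i\<in>I. \<Sum>l\<in>I. (\<Sum>n\<in>T. u n i * v n l)\<^sup>2) \<le> K * (\<Sum>l\<in>I. (\<Sum>n\<in>T. v n l)\<^sup>2)"
proof -
  have swap3: "(\<Sum>i\<in>I. \<Sum>l\<in>I. \<Sum>n\<in>T. f i l n) = (\<Sum>n\<in>T. \<Sum>i\<in>I. \<Sum>l\<in>I. f i l n)"
    for f :: "'i \<Rightarrow> 'i \<Rightarrow> 'n \<Rightarrow> real"
  proof -
    have "(\<Sum>i\<in>I. \<Sum>l\<in>I. \<Sum>n\<in>T. f i l n) = (\<Sum>i\<in>I. \<Sum>n\<in>T. \<Sum>l\<in>I. f i l n)"
      by (intro sum.cong refl sum.swap)
    also have "\<dots> = (\<Sum>n\<in>T. \<Sum>i\<in>I. \<Sum>l\<in>I. f i l n)" by (rule sum.swap)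
    finally show ?thesis .
  qed
  have "(\<Sum>i\<in>I. \<Sum>l\<in>I. (\<Sum>n\<in>T. u n i * v n l)\<^sup>2)
      = (\<Sum>i\<in>I. \<Sum>l\<in>I. \<Sum>n\<in>T. \<Sum>m\<in>T. (u n i * u m i) * (v n l * v m l))"
    by (simp add: power2_eq_square sum_product mult_ac)
  also have "\<dots> = (\<Sum>n\<in>T. \<Sum>m\<in>T. \<Sum>i\<in>I. \<Sum>l\<in>I. (u n i * u m i) * (v n l * v m l))"
    unfolding swap3 by (intro sum.cong refl swap3)
  also have "\<dots> = (\<Sum>n\<in>T. \<Sum>m\<in>T. (\<Sum>i\<in>I. u n i * u m i) * (\<Sum>l\<in>I. v n l * v m l))"
    by (simp add: sum_product)
  also have "\<dots> \<le> (\<Sum>n\<in>T. \<Sum>m\<in>T. K * (\<Sum>l\<in>I. v n l * v m l))"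
  proof (intro sum_mono mult_right_mono)
    fix n m assume nm: "n \<in> T" "m \<in> T"
    have "u n i * u m i \<le> ((u n i)\<^sup>2 + (u m i)\<^sup>2) / 2" for i
      using sum_squares_bound[of "u n i" "u m i"] by simp
    then have "(\<Sum>i\<in>I. u n i * u m i) \<le> (\<Sum>i\<in>I. ((u n i)\<^sup>2 + (u m i)\<^sup>2) / 2)"
      by (rule sum_mono)
    also have "\<dots> = ((\<Sum>i\<in>I. (u n i)\<^sup>2) + (\<Sum>i\<in>I. (u m i)\<^sup>2)) / 2"
      by (simp add: sum.distrib flip: sum_divide_distrib)
    also have "\<dots> \<le> K" using u[OF nm(1)] u[OF nm(2)] by argo
    finally show "(\<Sum>i\<in>I. u n i * u m i) \<le> K" .
    show "0 \<le> (\<Sum>l\<in>I. v n l * v m l)" using nm v by (intro sum_nonneg) auto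
  qed
  also have "\<dots> = K * (\<Sum>n\<in>T. \<Sum>m\<in>T. \<Sum>l\<in>I. v n l * v m l)"
    by (simp add: sum_distrib_left)
  also have "(\<Sum>n\<in>T. \<Sum>m\<in>T. \<Sum>l\<in>I. v n l * v m l) = (\<Sum>n\<in>T. \<Sum>l\<in>I. \<Sum>m\<in>T. v n l * v m l)"
    by (intro sum.cong refl sum.swap)
  also have "\<dots> = (\<Sum>l\<in>I. \<Sum>n\<in>T. \<Sum>m\<in>T. v n l * v m l)"
    by (rule sum.swap)
  also have "\<dots> = (\<Sum>l\<in>I. (\<Sum>n\<in>T. v n l)\<^sup>2)"
    by (simp add: power2_eq_square sum_product)
  finally show ?thesis .
qed

text \<open>
  The matrix of the quadratic form \<open>X 1 * X 2 + \<dots> + X (N - 1) * X N\<close> in the signs \<open>\<xi>\<close>.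
\<close>

definition lag_kernel :: "real \<Rightarrow> real \<Rightarrow> nat \<Rightarrow> nat \<Rightarrow> nat \<Rightarrow> real" where
  "lag_kernel H \<sigma> N i l = (\<Sum>n = 1..<N. X_coef H \<sigma> n i * X_coef H \<sigma> (Suc n) l)"

text \<open>
  Taking \<open>u\<close> and \<open>v\<close> to be the coefficients of \<open>X n\<close> and of \<open>X (n + 1)\<close> in the preceding estimate leaves
  the variance of \<open>X 2 + \<dots> + X N\<close>. The result is \<open>o(N\<^sup>2)\<close> because \<open>H < 1\<close>.
\<close>

lemma lag_kernel_square_sum_le:
  fixes H \<sigma> :: real
  assumes H: "1/2 < H" "H < 1" and s: "0 < \<sigma>"
  obtains C where "\<And>N. (\<Sum>i = 1..N. \<Sum>l = 1..N. (lag_kernel H \<sigma> N i l)\<^sup>2) \<le> C * real N powr (2 * H)"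
proof -
  obtain K where K: "0 < K" "\<And>n N. (\<Sum>i = 1..N. (X_coef H \<sigma> n i)\<^sup>2) \<le> K"
    using X_coef_square_sum_bounded[OF H s] by metis
  have nn: "0 \<le> X_coef H \<sigma> n i" if "1 \<le> i" "1 \<le> n" for i n
    using X_coef_nonneg[OF H s that] .
  have "(\<Sum>i = 1..N. \<Sum>l = 1..N. (lag_kernel H \<sigma> N i l)\<^sup>2)
     \<le> K * ((4 * \<sigma> * c_const H / (H - 1/2))\<^sup>2 / (2 - 2 * H)) * real N powr (2 * H)" for N
  proof -
    have "(\<Sum>i = 1..N. \<Sum>l = 1..N. (lag_kernel H \<sigma> N i l)\<^sup>2)
       \<le> K * (\<Sum>l = 1..N. (\<Sum>n = 1..<N. X_coef H \<sigma> (Suc n) l)\<^sup>2)"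
      unfolding lag_kernel_def by (rule sum_square_product_kernel_le) (use K nn in auto)
    also have "\<dots> \<le> K * (\<Sum>l = 1..N. (\<Sum>n = 1..N. X_coef H \<sigma> n l)\<^sup>2)"
    proof (intro mult_left_mono sum_mono power_mono)
      fix l assume l: "l \<in> {1..N}"
      have "(\<Sum>n = 1..<N. X_coef H \<sigma> (Suc n) l) = (\<Sum>n = Suc 1..N. X_coef H \<sigma> n l)"
        by (subst sum.shift_bounds_Suc_ivl[symmetric]) (simp add: atLeastLessThanSuc_atLeastAtMost)
      also have "\<dots> \<le> (\<Sum>n = 1..N. X_coef H \<sigma> n l)"
        by (rule sum_mono2) (use l nn in auto)
      finally show "(\<Sum>n = 1..<N. X_coef H \<sigma> (Suc n) l) \<le> (\<Sum>n = 1..N. X_coef H \<sigma> n l)" .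
    qed (use K nn in \<open>auto intro!: sum_nonneg\<close>)
    also have "\<dots> \<le> K * ((4 * \<sigma> * c_const H / (H - 1/2))\<^sup>2 / (2 - 2 * H) * real N powr (2 * H))"
      using X_coef_column_square_sum_le[OF H s, of N] K by (intro mult_left_mono) auto
    finally show ?thesis by (simp only: mult.assoc)
  qed
  then show ?thesis by (rule that)
qed


section \<open>Covariances of consecutive increments\<close>

text \<open>
  The left side is \<open>theta\<close> with its series truncated, and the right side is the covariance of \<open>X n\<close>
  and \<open>X (n + 1)\<close>. The terms with \<open>i < n\<close> dominate the series; the term \<open>i = n\<close> dominates
  \<open>2 * g_const\<^sup>2 * rho 1\<close>, where \<open>2 * rho 1 = 2 powr (H + 1/2) - 2\<close>.
\<close>

lemma lag_coef_inner_product_ge: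
  fixes H \<sigma> :: real
  assumes H: "1/2 < H" "H < 1" and s: "0 < \<sigma>" and n: "1 \<le> n" "n < N"
  shows "4 * (g_const H \<sigma>)\<^sup>2 * (\<Sum>k<n - 1. rho H (k + 2) * rho H (k + 1))
           + (g_const H \<sigma>)\<^sup>2 * (2 powr (H + 1/2) - 2)
         \<le> (\<Sum>i = 1..N. X_coef H \<sigma> n i * X_coef H \<sigma> (Suc n) i)"
proof -
  define g where "g = g_const H \<sigma>"
  have g: "0 < g" using g_const_pos[OF H s] by (simp add: g_def)
  have "2 * h_exp H = H + 1/2" by (simp add: h_exp_def)
  then have rho1: "2 * rho H 1 = 2 powr (H + 1/2) - 2" by (simp add: rho_def)
  have "4 * g\<^sup>2 * (\<Sum>k<n - 1. rho H (k + 2) * rho H (k + 1))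
      = (\<Sum>k<n - 1. (2 * g * rho H (k + 1)) * (2 * g * rho H (k + 2)))"
    by (simp add: sum_distrib_left power2_eq_square mult_ac)
  also have "\<dots> = (\<Sum>i = 1..<n. (2 * g * rho H (n - i)) * (2 * g * rho H (Suc n - i)))"
    by (rule sum.reindex_bij_witness[of _ "\<lambda>i. n - 1 - i" "\<lambda>k. n - 1 - k"])
      (auto simp: Suc_diff_Suc)
  also have "\<dots> \<le> (\<Sum>i = 1..<n. X_coef H \<sigma> n i * X_coef H \<sigma> (Suc n) i)"
  proof (intro sum_mono mult_mono)
    fix i assume i: "i \<in> {1..<n}"
    show "2 * g * rho H (n - i) \<le> X_coef H \<sigma> n i"
      using j_coef_bounds(1)[OF H s, of i n] i by (simp add: X_coef_def g_def)
    show "2 * g * rho H (Suc n - i) \<le> X_coef H \<sigma> (Suc n) i"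
      using j_coef_bounds(1)[OF H s, of i "Suc n"] i by (simp add: X_coef_def g_def)
    show "0 \<le> X_coef H \<sigma> n i" using X_coef_nonneg[OF H s, of i n] i by simp
    show "0 \<le> 2 * g * rho H (Suc n - i)"
      using i by (intro mult_nonneg_nonneg rho_nonneg H less_imp_le[OF g]) auto
  qed
  finally have 1: "4 * g\<^sup>2 * (\<Sum>k<n - 1. rho H (k + 2) * rho H (k + 1))
      \<le> (\<Sum>i = 1..<n. X_coef H \<sigma> n i * X_coef H \<sigma> (Suc n) i)" .
  have "g * (g * (2 * rho H 1)) \<le> X_coef H \<sigma> n n * X_coef H \<sigma> (Suc n) n"
  proof (intro mult_mono)
    show "g \<le> X_coef H \<sigma> n n"
      using g_coef_bounds(1)[OF H s n(1)] by (simp add: X_coef_def g_def)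
    show "g * (2 * rho H 1) \<le> X_coef H \<sigma> (Suc n) n"
      using j_coef_bounds(1)[OF H s n(1), of "Suc n"] by (simp add: X_coef_def g_def mult_ac)
    show "0 \<le> X_coef H \<sigma> n n" using X_coef_nonneg[OF H s n(1) n(1)] .
    show "0 \<le> g * (2 * rho H 1)" using g rho_nonneg[OF H, of 1] by simp
  qed
  then have 2: "g\<^sup>2 * (2 powr (H + 1/2) - 2) \<le> X_coef H \<sigma> n n * X_coef H \<sigma> (Suc n) n"
    unfolding rho1 by (simp add: power2_eq_square mult_ac)
  have "(\<Sum>i = 1..N. X_coef H \<sigma> n i * X_coef H \<sigma> (Suc n) i)
      = (\<Sum>i \<in> insert n {1..<n}. X_coef H \<sigma> n i * X_coef H \<sigma> (Suc n) i)"
    by (rule sum.mono_neutral_right) (use n in \<open>auto simp: X_coef_def\<close>)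
  with 1 2 show ?thesis by (simp add: g_def)
qed

text \<open>
  No asymptotics of \<open>rho\<close> are involved: the partial sums are dominated by covariances of
  consecutive increments, which are bounded because the variances are. As \<open>rho\<close>
  does not depend on the volatility, the covariances can be taken at volatility \<open>1\<close>.
\<close>

lemma rho_product_summable:
  fixes H :: real
  assumes H: "1/2 < H" "H < 1"
  shows "summable (\<lambda>k. rho H (k + 2) * rho H (k + 1))"
proof -
  define g where "g = g_const H 1"
  have g: "0 < g" using g_const_pos[OF H, of 1] by (simp add: g_def)
  obtain K where K: "\<And>n N. (\<Sum>i = 1..N. (X_coef H 1 n i)\<^sup>2) \<le> K"
    using X_coef_square_sum_bounded[OF H zero_less_one] by metis
  have p2: "2 \<le> 2 powr (H + 1/2)" using powr_mono[of 1 "H + 1/2" 2] H by simp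
  have nn: "0 \<le> rho H (k + 2) * rho H (k + 1)" for k
    using rho_nonneg[OF H] by simp
  have "(\<Sum>k<m. rho H (k + 2) * rho H (k + 1)) \<le> K / (4 * g\<^sup>2)" for m
  proof -
    have "4 * g\<^sup>2 * (\<Sum>k<m. rho H (k + 2) * rho H (k + 1))
        \<le> (\<Sum>i = 1..m + 2. X_coef H 1 (m + 1) i * X_coef H 1 (Suc (m + 1)) i)"
    proof -
      have "0 \<le> g\<^sup>2 * (2 powr (H + 1/2) - 2)" using p2 by simp
      with lag_coef_inner_product_ge[OF H, of 1 "m + 1" "m + 2"] show ?thesis
        unfolding g_def diff_add_inverse2 by linarith
    qed
    also have "\<dots> \<le> (\<Sum>i = 1..m + 2. ((X_coef H 1 (m + 1) i)\<^sup>2 + (X_coef H 1 (Suc (m + 1)) i)\<^sup>2) / 2)"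
    proof (rule sum_mono)
      fix i
      show "X_coef H 1 (m + 1) i * X_coef H 1 (Suc (m + 1)) i
          \<le> ((X_coef H 1 (m + 1) i)\<^sup>2 + (X_coef H 1 (Suc (m + 1)) i)\<^sup>2) / 2"
        using sum_squares_bound[of "X_coef H 1 (m + 1) i" "X_coef H 1 (Suc (m + 1)) i"] by simp
    qed
    also have "\<dots> = ((\<Sum>i = 1..m + 2. (X_coef H 1 (m + 1) i)\<^sup>2)
        + (\<Sum>i = 1..m + 2. (X_coef H 1 (Suc (m + 1)) i)\<^sup>2)) / 2"
      by (simp only: sum.distrib sum_divide_distrib[symmetric])
    also have "\<dots> \<le> K" using K[of "m + 1" "m + 2"] K[of "Suc (m + 1)" "m + 2"] by argo
    finally show ?thesis using g by (simp add: field_simps)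
  qed
  then show ?thesis by (intro summableI_nonneg_bounded nn)
qed

lemma theta_pos:
  fixes H \<sigma> :: real
  assumes H: "1/2 < H" "H < 1" and s: "0 < \<sigma>"
  shows "0 < theta H \<sigma>"
proof -
  have "2 < 2 powr (H + 1/2)" using powr_less_mono[of 1 "H + 1/2" 2] H by simp
  moreover have "0 \<le> (\<Sum>k. rho H (k + 2) * rho H (k + 1))"
    by (intro suminf_nonneg rho_product_summable H) (use rho_nonneg[OF H] in simp)
  ultimately show ?thesis
    using g_const_pos[OF H s] unfolding theta_def by (intro add_nonneg_pos mult_nonneg_nonneg mult_pos_pos) auto
qed

text \<open>
  The lower half of the Cesaro mean theorem, for nonnegative terms. With \<open>c < c' < L\<close>, discarding
  the finitely many terms below \<open>c'\<close> costs less than the gain \<open>(c' - c) * N\<close>.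
\<close>

lemma eventually_average_ge:
  fixes t :: "nat \<Rightarrow> real"
  assumes t: "t \<longlonglongrightarrow> L" and nn: "\<And>n. 0 \<le> t n" and c: "c < L"
  shows "\<forall>\<^sub>F N in sequentially. c * real N \<le> (\<Sum>n = 1..<N. t n)"
proof (cases "c \<le> 0")
  case True
  have "c * real N \<le> (\<Sum>n = 1..<N. t n)" for N
    using True nn by (intro order_trans[OF mult_nonpos_nonneg sum_nonneg]) auto
  then show ?thesis by simp
next
  case False
  obtain c' where c': "c < c'" "c' < L" using c dense by blast
  from order_tendstoD(1)[OF t c'(2)] obtain n0 where n0: "\<And>n. n \<ge> n0 \<Longrightarrow> c' < t n"
    by (auto simp: eventually_sequentially)
  have "\<forall>\<^sub>F N in sequentially. (real n0 + 1) * c' / (c' - c) \<le> real N"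
    by (rule eventually_ge_at_top[THEN filterlim_real_sequentially[THEN filterlim_iff[THEN iffD1], rule_format]])
  then show ?thesis
    using eventually_ge_at_top[of "n0 + 1"]
  proof eventually_elim
    case (elim N)
    have "c * real N \<le> (real N - (real n0 + 1)) * c'"
      using elim c' by (simp add: pos_divide_le_eq algebra_simps)
    also have "\<dots> = (\<Sum>n = n0 + 1..<N. c')" using elim by (simp add: of_nat_diff)
    also have "\<dots> \<le> (\<Sum>n = n0 + 1..<N. t n)"
      by (intro sum_mono less_imp_le n0) auto
    also have "\<dots> \<le> (\<Sum>n = 1..<N. t n)"
      by (rule sum_mono2) (auto simp: nn)
    finally show ?case .
  qed
qed

text \<open>
  The trace is the expectation of the quadratic form, so this bounds the mean of the final
  portfolio value from below by anything smaller than \<open>theta\<close>.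
\<close>

lemma lag_kernel_trace_eventually_ge:
  fixes H \<sigma> :: real
  assumes H: "1/2 < H" "H < 1" and s: "0 < \<sigma>" and c: "c < theta H \<sigma>"
  shows "\<forall>\<^sub>F N in sequentially. c * real N \<le> (\<Sum>i = 1..N. lag_kernel H \<sigma> N i i)"
proof -
  define t where "t n = 4 * (g_const H \<sigma>)\<^sup>2 * (\<Sum>k<n - 1. rho H (k + 2) * rho H (k + 1))
           + (g_const H \<sigma>)\<^sup>2 * (2 powr (H + 1/2) - 2)" for n
  have p2: "2 \<le> 2 powr (H + 1/2)" using powr_mono[of 1 "H + 1/2" 2] H by simp
  have nn: "0 \<le> t n" for n
    unfolding t_def using p2 rho_nonneg[OF H]
    by (intro add_nonneg_nonneg mult_nonneg_nonneg sum_nonneg) auto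
  have "(\<lambda>n. \<Sum>k<n. rho H (k + 2) * rho H (k + 1)) \<longlonglongrightarrow> (\<Sum>k. rho H (k + 2) * rho H (k + 1))"
    by (rule summable_LIMSEQ[OF rho_product_summable[OF H]])
  then have "(\<lambda>n. \<Sum>k<n - 1. rho H (k + 2) * rho H (k + 1)) \<longlonglongrightarrow> (\<Sum>k. rho H (k + 2) * rho H (k + 1))"
    by (subst filterlim_sequentially_Suc[symmetric]) simp
  then have "t \<longlonglongrightarrow> theta H \<sigma>"
    unfolding t_def theta_def by (intro tendsto_intros)
  from eventually_average_ge[OF this nn c] show ?thesis
  proof eventually_elim
    case (elim N)
    also have "(\<Sum>n = 1..<N. t n) \<le> (\<Sum>n = 1..<N. \<Sum>i = 1..N. X_coef H \<sigma> n i * X_coef H \<sigma> (Suc n) i)"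
      unfolding t_def by (intro sum_mono lag_coef_inner_product_ge H s) auto
    also have "\<dots> = (\<Sum>i = 1..N. lag_kernel H \<sigma> N i i)"
      unfolding lag_kernel_def by (rule sum.swap)
    finally show ?case .
  qed
qed

section \<open>The value of the strategy\<close>

lemma portfolio_value_eq_gains:
  assumes "\<phi> (-1) = 0" "\<phi> 0 = 0"
  shows "portfolio_value S (bond_position S \<phi>) \<phi> n = (\<Sum>k<n. \<phi> (int k) * (S (Suc k) - S k))"
proof (induction n)
  case 0
  have "bond_position S \<phi> 0 = 0"
    using bond_position_self_financing[of 0 S \<phi>] bond_position_initial[of S \<phi>] assms by simp
  then show ?case using assms by (simp add: portfolio_value_def)
next
  case (Suc n)
  have "bond_position S \<phi> (int (Suc n)) - bond_position S \<phi> (int n)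
      = - (\<phi> (int (Suc n)) - \<phi> (int n)) * S (Suc n)"
    using bond_position_self_financing[of "int (Suc n)" S \<phi>] by (simp add: nat_add_distrib)
  then show ?case using Suc.IH by (simp add: portfolio_value_def algebra_simps)
qed

lemma strat_value_eq_gains:
  "strat_value H \<sigma> s0 \<xi> N n \<omega> = (\<Sum>k<n. strat_stock H \<sigma> s0 \<xi> N \<omega> (int k) *
     (stock_price H \<sigma> s0 \<xi> N (Suc k) \<omega> - stock_price H \<sigma> s0 \<xi> N k \<omega>))"
  unfolding strat_value_def strat_bond_def
  by (rule portfolio_value_eq_gains) (auto simp: strat_stock_def)

lemma stock_price_nonzero:
  assumes "s0 \<noteq> 0" "\<And>k. 1 \<le> k \<Longrightarrow> k \<le> n \<Longrightarrow> 1 + X_proc H \<sigma> \<xi> k \<omega> / real N powr H \<noteq> 0"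
  shows "stock_price H \<sigma> s0 \<xi> N n \<omega> \<noteq> 0"
  using assms(2)
proof (induction n)
  case (Suc n)
  then show ?case by simp
qed (use assms(1) in simp)

text \<open>
  The stock position at time \<open>k\<close> is proportional to \<open>X k / S k\<close> and the next price change is
  proportional to \<open>X (k + 1) * S k\<close>, so the price cancels, and the powers of \<open>N\<close> combine to \<open>1/N\<close>.
\<close>

lemma strat_value_eq_lag_sum:
  assumes s0: "s0 \<noteq> 0"
    and nz: "\<And>k. 1 \<le> k \<Longrightarrow> k \<le> N \<Longrightarrow> 1 + X_proc H \<sigma> \<xi> k \<omega> / real N powr H \<noteq> 0"
  shows "strat_value H \<sigma> s0 \<xi> N N \<omega> =
           (\<Sum>n = 1..<N. X_proc H \<sigma> \<xi> n \<omega> * X_proc H \<sigma> \<xi> (Suc n) \<omega>) / real N"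
proof (cases "N = 0")
  case False
  let ?X = "\<lambda>n. X_proc H \<sigma> \<xi> n \<omega>" and ?S = "\<lambda>n. stock_price H \<sigma> s0 \<xi> N n \<omega>"
  have N: "real N powr (H - 1) / real N powr H = 1 / real N"
    using False by (simp flip: powr_diff add: powr_minus_divide)
  have "strat_value H \<sigma> s0 \<xi> N N \<omega>
      = (\<Sum>n = 1..<N. strat_stock H \<sigma> s0 \<xi> N \<omega> (int n) * (?S (Suc n) - ?S n))"
    unfolding strat_value_eq_gains
    by (rule sum.mono_neutral_right) (auto simp: strat_stock_def not_le)
  also have "\<dots> = (\<Sum>n = 1..<N. (?X n * ?X (Suc n)) / real N)"
  proof (rule sum.cong[OF refl])
    fix n assume n: "n \<in> {1..<N}"
    have S: "?S n \<noteq> 0" by (rule stock_price_nonzero[OF s0]) (use nz n in auto)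
    have "strat_stock H \<sigma> s0 \<xi> N \<omega> (int n) * (?S (Suc n) - ?S n)
        = (real N powr (H - 1) / real N powr H) * (?X n * ?X (Suc n)) * (?S n / ?S n)"
      using n by (simp add: strat_stock_def algebra_simps)
    then show "strat_stock H \<sigma> s0 \<xi> N \<omega> (int n) * (?S (Suc n) - ?S n) = (?X n * ?X (Suc n)) / real N"
      using S unfolding N by simp
  qed
  finally show ?thesis by (simp add: sum_divide_distrib)
qed (simp add: strat_value_eq_gains)

text \<open>
  A pathwise bound. As \<open>N\<close> is smaller than \<open>N powr (2 * H)\<close> in order, it shows that for large \<open>N\<close> no
  price factor \<open>1 + X n / N powr H\<close> can vanish.
\<close>

lemma X_proc_square_le:
  fixes H \<sigma> :: real
  assumes K: "\<And>N. (\<Sum>i = 1..N. (X_coef H \<sigma> n i)\<^sup>2) \<le> K"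
    and n: "1 \<le> n" "n \<le> N" and \<xi>: "\<And>i. 1 \<le> i \<Longrightarrow> (\<xi> i \<omega>)\<^sup>2 = 1"
  shows "(X_proc H \<sigma> \<xi> n \<omega>)\<^sup>2 \<le> K * real N"
proof -
  have "(X_proc H \<sigma> \<xi> n \<omega>)\<^sup>2 \<le> (\<Sum>i = 1..N. (X_coef H \<sigma> n i)\<^sup>2) * (\<Sum>i = 1..N. (\<xi> i \<omega>)\<^sup>2)"
    unfolding X_proc_eq_sum[OF n] by (rule Cauchy_Schwarz_ineq_sum)
  also have "(\<Sum>i = 1..N. (\<xi> i \<omega>)\<^sup>2) = real N" using \<xi> by simp
  also have "(\<Sum>i = 1..N. (X_coef H \<sigma> n i)\<^sup>2) * real N \<le> K * real N"
    using K by (rule mult_right_mono) simp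
  finally show ?thesis .
qed

lemma lag_sum_eq_quadratic_form:
  "(\<Sum>n = 1..<N. X_proc H \<sigma> \<xi> n \<omega> * X_proc H \<sigma> \<xi> (Suc n) \<omega>) =
     (\<Sum>i = 1..N. \<Sum>l = 1..N. lag_kernel H \<sigma> N i l * (\<xi> i \<omega> * \<xi> l \<omega>))"
proof -
  have "(\<Sum>n = 1..<N. X_proc H \<sigma> \<xi> n \<omega> * X_proc H \<sigma> \<xi> (Suc n) \<omega>)
      = (\<Sum>n = 1..<N. \<Sum>i = 1..N. \<Sum>l = 1..N. X_coef H \<sigma> n i * X_coef H \<sigma> (Suc n) l * (\<xi> i \<omega> * \<xi> l \<omega>))"
    by (intro sum.cong refl) (simp add: X_proc_eq_sum[of _ N] sum_product mult_ac)
  also have "\<dots> = (\<Sum>i = 1..N. \<Sum>n = 1..<N. \<Sum>l = 1..N. X_coef H \<sigma> n i * X_coef H \<sigma> (Suc n) l * (\<xi> i \<omega> * \<xi> l \<omega>))"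
    by (rule sum.swap)
  also have "\<dots> = (\<Sum>i = 1..N. \<Sum>l = 1..N. \<Sum>n = 1..<N. X_coef H \<sigma> n i * X_coef H \<sigma> (Suc n) l * (\<xi> i \<omega> * \<xi> l \<omega>))"
    by (intro sum.cong refl sum.swap)
  finally show ?thesis by (simp add: lag_kernel_def sum_distrib_right)
qed


section \<open>Quadratic forms in independent random signs\<close>

text \<open>
  Products of distinct signs are the Walsh functions; by independence they have mean zero,
  except for the empty product.
\<close>

lemma (in prob_space) random_sign_product:
  fixes \<xi> :: "nat \<Rightarrow> 'a \<Rightarrow> real"
  assumes ind: "indep_vars (\<lambda>_. borel) \<xi> I"
    and sq: "\<And>i. i \<in> I \<Longrightarrow> AE \<omega> in M. (\<xi> i \<omega>)\<^sup>2 = 1"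
    and mean: "\<And>i. i \<in> I \<Longrightarrow> expectation (\<xi> i) = 0"
    and T: "finite T" "T \<subseteq> I"
  shows "integrable M (\<lambda>\<omega>. \<Prod>t\<in>T. \<xi> t \<omega>)"
    and "expectation (\<lambda>\<omega>. \<Prod>t\<in>T. \<xi> t \<omega>) = (if T = {} then 1 else 0)"
proof -
  have indT: "indep_vars (\<lambda>_. borel) \<xi> T" by (rule indep_vars_subset[OF ind T(2)])
  have int: "integrable M (\<xi> i)" if "i \<in> T" for i
  proof (rule integrable_const_bound[where B = 1])
    have "AE \<omega> in M. (\<xi> i \<omega>)\<^sup>2 = 1" using sq that T by blast
    then show "AE \<omega> in M. norm (\<xi> i \<omega>) \<le> 1"
      by eventually_elim (auto simp: power2_eq_1_iff)
    show "\<xi> i \<in> borel_measurable M" using indT that by (auto simp: indep_vars_def)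
  qed
  show "integrable M (\<lambda>\<omega>. \<Prod>t\<in>T. \<xi> t \<omega>)"
    by (rule indep_vars_integrable[OF T(1) indT int])
  have "expectation (\<lambda>\<omega>. \<Prod>t\<in>T. \<xi> t \<omega>) = (\<Prod>t\<in>T. expectation (\<xi> t))"
    by (rule indep_vars_lebesgue_integral[OF T(1) indT int])
  also have "\<dots> = (if T = {} then 1 else 0)"
    using mean T by (auto simp: subset_iff intro!: prod_zero)
  finally show "expectation (\<lambda>\<omega>. \<Prod>t\<in>T. \<xi> t \<omega>) = (if T = {} then 1 else 0)" .
qed

lemma sign_product_mult:
  fixes f :: "nat \<Rightarrow> real"
  assumes "finite S" "finite T" "\<And>i. i \<in> S \<union> T \<Longrightarrow> (f i)\<^sup>2 = 1"
  shows "prod f S * prod f T = prod f (sym_diff S T)"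
proof -
  have S: "prod f S = prod f (S - T) * prod f (S \<inter> T)"
    using assms prod.Int_Diff[of S f T] by (simp add: mult.commute)
  have T: "prod f T = prod f (T - S) * prod f (S \<inter> T)"
    using assms prod.Int_Diff[of T f S] by (simp add: mult.commute Int_commute)
  have "prod f (S \<inter> T) * prod f (S \<inter> T) = (\<Prod>i\<in>S \<inter> T. (f i)\<^sup>2)"
    by (simp add: prod.distrib power2_eq_square)
  also have "\<dots> = 1" using assms by simp
  finally have 1: "prod f (S \<inter> T) * prod f (S \<inter> T) = 1" .
  have "prod f S * prod f T = prod f (S - T) * prod f (T - S) * (prod f (S \<inter> T) * prod f (S \<inter> T))"
    unfolding S T by simp
  also have "\<dots> = prod f (sym_diff S T)"
    unfolding 1 using assms by (subst prod.union_disjoint) auto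
  finally show ?thesis .
qed

text \<open>
  Walsh functions are orthonormal: since squared signs are \<open>1\<close>, the product of those for two sets is
  the one for the symmetric difference, which is empty only if the sets coincide.
\<close>

lemma (in prob_space) random_sign_chaos_second_moment:
  fixes \<xi> :: "nat \<Rightarrow> 'a \<Rightarrow> real" and c :: "'p \<Rightarrow> real"
  assumes ind: "indep_vars (\<lambda>_. borel) \<xi> I"
    and sq: "\<And>i. i \<in> I \<Longrightarrow> AE \<omega> in M. (\<xi> i \<omega>)\<^sup>2 = 1"
    and mean: "\<And>i. i \<in> I \<Longrightarrow> expectation (\<xi> i) = 0"
    and I: "finite I" and T: "\<And>p. p \<in> P \<Longrightarrow> T p \<subseteq> I" "inj_on T P"
  defines "Q \<equiv> \<lambda>\<omega>. (\<Sum>p\<in>P. c p * (\<Prod>t\<in>T p. \<xi> t \<omega>))\<^sup>2"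
  shows "integrable M Q" and "expectation Q = (\<Sum>p\<in>P. (c p)\<^sup>2)"
proof -
  have P: "finite P"
    using finite_subset[of "T ` P" "Pow I"] I T by (auto dest: finite_imageD)
  have fT: "finite (T p)" if "p \<in> P" for p using T(1)[OF that] I by (rule finite_subset)
  have sD: "finite (sym_diff (T p) (T q))" "sym_diff (T p) (T q) \<subseteq> I" if "p \<in> P" "q \<in> P" for p q
    using that T fT by auto
  have "AE \<omega> in M. \<forall>i\<in>I. (\<xi> i \<omega>)\<^sup>2 = 1" using I sq by (subst AE_finite_all) auto
  then have ae: "AE \<omega> in M. Q \<omega> = (\<Sum>p\<in>P. \<Sum>q\<in>P. c p * c q * (\<Prod>t\<in>sym_diff (T p) (T q). \<xi> t \<omega>))"
  proof eventually_elim
    case (elim \<omega>)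
    have "Q \<omega> = (\<Sum>p\<in>P. \<Sum>q\<in>P. c p * c q * ((\<Prod>t\<in>T p. \<xi> t \<omega>) * (\<Prod>t\<in>T q. \<xi> t \<omega>)))"
      by (simp add: Q_def power2_eq_square sum_product mult_ac)
    also have "\<dots> = (\<Sum>p\<in>P. \<Sum>q\<in>P. c p * c q * (\<Prod>t\<in>sym_diff (T p) (T q). \<xi> t \<omega>))"
    proof (intro sum.cong refl)
      fix p q assume "p \<in> P" "q \<in> P"
      then show "c p * c q * ((\<Prod>t\<in>T p. \<xi> t \<omega>) * (\<Prod>t\<in>T q. \<xi> t \<omega>))
          = c p * c q * (\<Prod>t\<in>sym_diff (T p) (T q). \<xi> t \<omega>)"
        using fT T(1) elim by (subst sign_product_mult) auto
    qed
    finally show ?case .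
  qed
  have meas: "\<xi> i \<in> borel_measurable M" if "i \<in> I" for i
    using ind that by (auto simp: indep_vars_def)
  have QM: "Q \<in> borel_measurable M"
    unfolding Q_def using T(1) by (intro borel_measurable_power borel_measurable_sum borel_measurable_times
        borel_measurable_const borel_measurable_prod meas) auto
  note w = random_sign_product[OF ind sq mean sD]
  have int: "integrable M (\<lambda>\<omega>. \<Sum>p\<in>P. \<Sum>q\<in>P. c p * c q * (\<Prod>t\<in>sym_diff (T p) (T q). \<xi> t \<omega>))"
    by (intro Bochner_Integration.integrable_sum integrable_mult_right w)
  show "integrable M Q"
    using integrable_cong_AE[OF QM borel_measurable_integrable[OF int] ae] int by simp
  have "expectation Q = (\<integral>\<omega>. (\<Sum>p\<in>P. \<Sum>q\<in>P. c p * c q * (\<Prod>t\<in>sym_diff (T p) (T q). \<xi> t \<omega>)) \<partial>M)"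
    by (rule integral_cong_AE[OF QM borel_measurable_integrable[OF int] ae])
  also have "\<dots> = (\<Sum>p\<in>P. \<Sum>q\<in>P. c p * c q * (if sym_diff (T p) (T q) = {} then 1 else 0))"
    using w by (simp add: Bochner_Integration.integral_sum)
  also have "\<dots> = (\<Sum>p\<in>P. \<Sum>q\<in>P. if p = q then (c p)\<^sup>2 else 0)"
    using T(2) by (intro sum.cong refl) (auto simp: inj_on_def power2_eq_square)
  also have "\<dots> = (\<Sum>p\<in>P. (c p)\<^sup>2)" using P by simp
  finally show "expectation Q = (\<Sum>p\<in>P. (c p)\<^sup>2)" .
qed

lemma double_sum_split_diagonal:
  fixes f :: "nat \<Rightarrow> nat \<Rightarrow> real"
  assumes "finite I"
  shows "(\<Sum>i\<in>I. \<Sum>l\<in>I. f i l) = (\<Sum>i\<in>I. f i i) + (\<Sum>p\<in>{p\<in>I \<times> I. fst p < snd p}. f (fst p) (snd p) + f (snd p) (fst p))"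
proof -
  let ?L = "{p\<in>I \<times> I. fst p < snd p}" and ?G = "{p\<in>I \<times> I. snd p < fst p}" and ?D = "{p\<in>I \<times> I. fst p = snd p}"
  let ?h = "\<lambda>p. f (fst p) (snd p)"
  have "(\<Sum>i\<in>I. \<Sum>l\<in>I. f i l) = sum ?h (I \<times> I)" by (simp add: sum.cartesian_product split_def)
  also have "I \<times> I = ?D \<union> (?L \<union> ?G)" by auto
  also have "sum ?h \<dots> = sum ?h ?D + (sum ?h ?L + sum ?h ?G)"
    using assms by (subst sum.union_disjoint, simp, simp, fastforce, subst sum.union_disjoint) auto
  also have "sum ?h ?D = (\<Sum>i\<in>I. f i i)"
    by (rule sum.reindex_bij_witness[of _ "\<lambda>i. (i, i)" fst]) auto
  also have "sum ?h ?G = (\<Sum>p\<in>?L. f (snd p) (fst p))"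
    by (rule sum.reindex_bij_witness[of _ prod.swap prod.swap]) auto
  finally show ?thesis by (simp add: sum.distrib)
qed

text \<open>
  The squared signs on the diagonal are \<open>1\<close>, so subtracting the trace leaves a combination of the
  Walsh functions of two-element sets. The set of two indices \<open>i < l\<close> carries the coefficient
  \<open>B i l + B l i\<close>, whence the factor \<open>2\<close>.
\<close>

lemma (in prob_space) random_sign_quadratic_form_variance:
  fixes \<xi> :: "nat \<Rightarrow> 'a \<Rightarrow> real" and B :: "nat \<Rightarrow> nat \<Rightarrow> real"
  assumes ind: "indep_vars (\<lambda>_. borel) \<xi> I"
    and sq: "\<And>i. i \<in> I \<Longrightarrow> AE \<omega> in M. (\<xi> i \<omega>)\<^sup>2 = 1"
    and mean: "\<And>i. i \<in> I \<Longrightarrow> expectation (\<xi> i) = 0"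
    and I: "finite I"
  defines "Q \<equiv> \<lambda>\<omega>. ((\<Sum>i\<in>I. \<Sum>l\<in>I. B i l * (\<xi> i \<omega> * \<xi> l \<omega>)) - (\<Sum>i\<in>I. B i i))\<^sup>2"
  shows "integrable M Q" and "expectation Q \<le> 2 * (\<Sum>i\<in>I. \<Sum>l\<in>I. (B i l)\<^sup>2)"
proof -
  define P where "P = {p\<in>I \<times> I. fst p < snd p}"
  define c where "c p = B (fst p) (snd p) + B (snd p) (fst p)" for p
  define T where "T p = {fst p, snd p}" for p :: "nat \<times> nat"
  define Q' where "Q' \<omega> = (\<Sum>p\<in>P. c p * (\<Prod>t\<in>T p. \<xi> t \<omega>))\<^sup>2" for \<omega>
  have TI: "T p \<subseteq> I" if "p \<in> P" for p using that by (auto simp: T_def P_def)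
  have inj: "inj_on T P"
    by (rule inj_onI) (auto simp: T_def P_def doubleton_eq_iff prod_eq_iff)
  note * = random_sign_chaos_second_moment[OF ind sq mean I TI inj, where c = c, folded Q'_def]
  have "AE \<omega> in M. \<forall>i\<in>I. (\<xi> i \<omega>)\<^sup>2 = 1" using I sq by (subst AE_finite_all) auto
  then have ae: "AE \<omega> in M. Q \<omega> = Q' \<omega>"
  proof eventually_elim
    case (elim \<omega>)
    have "(\<Sum>i\<in>I. \<Sum>l\<in>I. B i l * (\<xi> i \<omega> * \<xi> l \<omega>)) = (\<Sum>i\<in>I. B i i * (\<xi> i \<omega> * \<xi> i \<omega>))
        + (\<Sum>p\<in>P. B (fst p) (snd p) * (\<xi> (fst p) \<omega> * \<xi> (snd p) \<omega>)
                  + B (snd p) (fst p) * (\<xi> (snd p) \<omega> * \<xi> (fst p) \<omega>))"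
      unfolding P_def by (rule double_sum_split_diagonal[OF I])
    also have "(\<Sum>i\<in>I. B i i * (\<xi> i \<omega> * \<xi> i \<omega>)) = (\<Sum>i\<in>I. B i i)"
      using elim by (simp add: power2_eq_square)
    also have "(\<Sum>p\<in>P. B (fst p) (snd p) * (\<xi> (fst p) \<omega> * \<xi> (snd p) \<omega>)
                  + B (snd p) (fst p) * (\<xi> (snd p) \<omega> * \<xi> (fst p) \<omega>)) = (\<Sum>p\<in>P. c p * (\<Prod>t\<in>T p. \<xi> t \<omega>))"
      by (intro sum.cong refl) (auto simp: c_def T_def P_def algebra_simps)
    finally show ?case by (simp add: Q_def Q'_def)
  qed
  have meas: "\<xi> i \<in> borel_measurable M" if "i \<in> I" for i
    using ind that by (auto simp: indep_vars_def)
  have QM: "Q \<in> borel_measurable M"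
    unfolding Q_def by (intro borel_measurable_power borel_measurable_sum borel_measurable_times
        borel_measurable_diff borel_measurable_const meas) auto
  have Q'M: "Q' \<in> borel_measurable M" using *(1) by (simp add: Q'_def[abs_def])
  show "integrable M Q"
    using integrable_cong_AE[OF QM Q'M ae] *(1) by (simp add: Q'_def[abs_def])
  have "expectation Q = expectation Q'" by (rule integral_cong_AE[OF QM Q'M ae])
  also have "\<dots> = (\<Sum>p\<in>P. (c p)\<^sup>2)" using *(2) by (simp add: Q'_def[abs_def])
  also have "\<dots> \<le> (\<Sum>p\<in>P. 2 * ((B (fst p) (snd p))\<^sup>2 + (B (snd p) (fst p))\<^sup>2))"
  proof (rule sum_mono)
    fix p
    show "(c p)\<^sup>2 \<le> 2 * ((B (fst p) (snd p))\<^sup>2 + (B (snd p) (fst p))\<^sup>2)"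
      using sum_squares_bound[of "B (fst p) (snd p)" "B (snd p) (fst p)"]
      by (simp add: c_def power2_sum)
  qed
  also have "\<dots> \<le> 2 * (\<Sum>i\<in>I. \<Sum>l\<in>I. (B i l)\<^sup>2)"
    unfolding double_sum_split_diagonal[OF I, of "\<lambda>i l. (B i l)\<^sup>2"] P_def[symmetric]
    by (simp add: sum_distrib_left sum_nonneg)
  finally show "expectation Q \<le> 2 * (\<Sum>i\<in>I. \<Sum>l\<in>I. (B i l)\<^sup>2)" .
qed

lemma (in prob_space) random_sign_moments:
  fixes X :: "'a \<Rightarrow> real"
  assumes [measurable]: "random_variable borel X"
    and p1: "prob {\<omega> \<in> space M. X \<omega> = 1} = 1/2" and p2: "prob {\<omega> \<in> space M. X \<omega> = -1} = 1/2"
  shows "AE \<omega> in M. (X \<omega>)\<^sup>2 = 1" and "expectation X = 0"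
proof -
  let ?A = "{\<omega> \<in> space M. X \<omega> = 1}" and ?B = "{\<omega> \<in> space M. X \<omega> = -1}"
  have "prob (?A \<union> ?B) = prob ?A + prob ?B"
    by (rule finite_measure_Union) auto
  then have "AE \<omega> in M. \<omega> \<in> ?A \<union> ?B" using p1 p2 by (intro AE_prob_1) simp
  then have ae: "AE \<omega> in M. X \<omega> = 1 \<or> X \<omega> = -1" by eventually_elim auto
  then show "AE \<omega> in M. (X \<omega>)\<^sup>2 = 1" by eventually_elim auto
  have "expectation X = expectation (\<lambda>\<omega>. indicator ?A \<omega> - indicator ?B \<omega>)"
  proof (rule integral_cong_AE)
    show "AE \<omega> in M. X \<omega> = indicator ?A \<omega> - indicator ?B \<omega>"
      using ae AE_space by eventually_elim (auto simp: indicator_def)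
  qed measurable
  also have "\<dots> = prob ?A - prob ?B"
    by (subst Bochner_Integration.integral_diff) (auto simp: integrable_indicator_iff less_top[symmetric])
  finally show "expectation X = 0" using p1 p2 by simp
qed

section \<open>Convergence in probability\<close>

lemma borel_measurable_strat_value:
  fixes \<xi> :: "nat \<Rightarrow> 'a \<Rightarrow> real"
  assumes \<xi>: "\<And>i. 1 \<le> i \<Longrightarrow> \<xi> i \<in> borel_measurable M"
  shows "(\<lambda>\<omega>. strat_value H \<sigma> s0 \<xi> N n \<omega>) \<in> borel_measurable M"
proof -
  have X: "(\<lambda>\<omega>. X_proc H \<sigma> \<xi> k \<omega>) \<in> borel_measurable M" if "1 \<le> k" for k
    unfolding X_proc_def Y_proc_def
    by (intro borel_measurable_add borel_measurable_sum borel_measurable_times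
        borel_measurable_const \<xi>) (use that in auto)
  have S: "(\<lambda>\<omega>. stock_price H \<sigma> s0 \<xi> N k \<omega>) \<in> borel_measurable M" for k
  proof (induction k)
    case (Suc k)
    note [measurable] = Suc X[of "Suc k", simplified]
    show ?case unfolding stock_price.simps by measurable
  qed simp
  have st: "(\<lambda>\<omega>. strat_stock H \<sigma> s0 \<xi> N \<omega> (int k)) \<in> borel_measurable M" for k
  proof (cases "k = 0")
    case False
    note [measurable] = S[of k] X[of k, simplified]
    show ?thesis using False unfolding strat_stock_def by simp
  qed (simp add: strat_stock_def)
  show ?thesis
    unfolding strat_value_eq_gains
    by (intro borel_measurable_sum borel_measurable_times borel_measurable_diff st S)
qed


text \<open>
  The event that the final value misses its target is contained in the event that the quadratic
  form deviates from its mean by the order of \<open>N\<close>. This is where the prices are seen to be nonzero: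
  a vanishing price factor would force \<open>(X k)\<^sup>2 = N powr (2 * H)\<close>.
\<close>

lemma strat_value_small_imp_deviation:
  fixes H \<sigma> \<epsilon> :: real
  assumes s0: "s0 \<noteq> 0" and N: "1 \<le> N" and \<epsilon>: "0 < \<epsilon>" and \<theta>: "0 < \<theta>"
    and K: "\<And>n N. (\<Sum>i = 1..N. (X_coef H \<sigma> n i)\<^sup>2) \<le> K" "K * real N < real N powr (2 * H)"
    and trace: "\<theta> * (1 - \<epsilon>/2) * real N \<le> (\<Sum>i = 1..N. lag_kernel H \<sigma> N i i)"
    and \<xi>: "\<And>i. 1 \<le> i \<Longrightarrow> (\<xi> i \<omega>)\<^sup>2 = 1"
    and V: "strat_value H \<sigma> s0 \<xi> N N \<omega> \<le> \<theta> * (1 - \<epsilon>)"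
  shows "(\<theta> * \<epsilon> / 2 * real N)\<^sup>2 \<le>
    ((\<Sum>i = 1..N. \<Sum>l = 1..N. lag_kernel H \<sigma> N i l * (\<xi> i \<omega> * \<xi> l \<omega>)) - (\<Sum>i = 1..N. lag_kernel H \<sigma> N i i))\<^sup>2"
proof -
  have nz: "1 + X_proc H \<sigma> \<xi> k \<omega> / real N powr H \<noteq> 0" if k: "1 \<le> k" "k \<le> N" for k
  proof
    assume "1 + X_proc H \<sigma> \<xi> k \<omega> / real N powr H = 0"
    then have "X_proc H \<sigma> \<xi> k \<omega> = - (real N powr H)" using N by (simp add: field_simps)
    then have "(X_proc H \<sigma> \<xi> k \<omega>)\<^sup>2 = real N powr (2 * H)"
      by (simp add: power2_eq_square flip: powr_add)
    moreover have "(X_proc H \<sigma> \<xi> k \<omega>)\<^sup>2 \<le> K * real N"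
      by (rule X_proc_square_le[OF K(1) k]) (rule \<xi>)
    ultimately show False using K(2) by simp
  qed
  let ?Q = "\<Sum>i = 1..N. \<Sum>l = 1..N. lag_kernel H \<sigma> N i l * (\<xi> i \<omega> * \<xi> l \<omega>)"
  have "strat_value H \<sigma> s0 \<xi> N N \<omega> = ?Q / real N"
    using strat_value_eq_lag_sum[OF s0 nz] unfolding lag_sum_eq_quadratic_form .
  then have "?Q \<le> \<theta> * (1 - \<epsilon>) * real N" using V N by (simp add: pos_divide_le_eq)
  then have "\<theta> * \<epsilon> / 2 * real N \<le> - (?Q - (\<Sum>i = 1..N. lag_kernel H \<sigma> N i i))"
    using trace by (simp add: algebra_simps)
  then have "(\<theta> * \<epsilon> / 2 * real N)\<^sup>2 \<le> (- (?Q - (\<Sum>i = 1..N. lag_kernel H \<sigma> N i i)))\<^sup>2"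
    using \<epsilon> \<theta> by (intro power_mono) auto
  then show ?thesis unfolding power2_minus .
qed

theorem corollary3p5:
  fixes H \<sigma> s0 \<epsilon> :: real
    and M :: "'a measure"
    and \<xi> :: "nat \<Rightarrow> 'a \<Rightarrow> real"
  assumes "1/2 < H" and "H < 1" and "0 < \<sigma>" and "0 < s0"
    and "prob_space M"
    and "prob_space.indep_vars M (\<lambda>_. borel) \<xi> {1..}"
    and "\<And>i. 1 \<le> i \<Longrightarrow> distr M borel (\<xi> i) = distr M borel (\<xi> 1)"
    and "measure M {\<omega> \<in> space M. \<xi> 1 \<omega> = 1} = 1/2"
    and "measure M {\<omega> \<in> space M. \<xi> 1 \<omega> = -1} = 1/2"
    and "0 < \<epsilon>"
  shows "(\<lambda>N. measure M {\<omega> \<in> space M. strat_value H \<sigma> s0 \<xi> N N \<omega> > theta H \<sigma> * (1 - \<epsilon>)})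
           \<longlonglongrightarrow> 1"
proof -
  interpret prob_space M by fact
  note H = assms(1,2) and s = assms(3)
  have s0: "s0 \<noteq> 0" using assms(4) by simp
  have rv: "\<xi> i \<in> borel_measurable M" if "1 \<le> i" for i
    using assms(6) that by (auto simp: indep_vars_def)
  have law: "prob {\<omega> \<in> space M. \<xi> i \<omega> = x} = prob {\<omega> \<in> space M. \<xi> 1 \<omega> = x}" if i: "1 \<le> i" for i x
  proof -
    have distr: "prob {\<omega> \<in> space M. \<xi> j \<omega> = x} = measure (distr M borel (\<xi> j)) {x}" if "1 \<le> j" for j
      by (subst measure_distr[OF rv[OF that]]) (auto intro!: arg_cong[where f = prob])
    show ?thesis using distr[OF i] distr[of 1] by (simp only: assms(7)[OF i] order_refl)
  qed
  have sq: "AE \<omega> in M. (\<xi> i \<omega>)\<^sup>2 = 1" and mean: "expectation (\<xi> i) = 0" if i: "1 \<le> i" for i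
    using random_sign_moments[OF rv[OF i]] law[OF i] assms(8,9) by auto
  have ae: "AE \<omega> in M. \<forall>i. 1 \<le> i \<longrightarrow> (\<xi> i \<omega>)\<^sup>2 = 1"
    unfolding AE_all_countable using sq by simp
  obtain K where K: "0 < K" "\<And>n N. (\<Sum>i = 1..N. (X_coef H \<sigma> n i)\<^sup>2) \<le> K"
    using X_coef_square_sum_bounded[OF H s] by metis
  obtain C where C: "\<And>N. (\<Sum>i = 1..N. \<Sum>l = 1..N. (lag_kernel H \<sigma> N i l)\<^sup>2) \<le> C * real N powr (2 * H)"
    using lag_kernel_square_sum_le[OF H s] by metis
  define \<theta> where "\<theta> = theta H \<sigma>"
  have \<theta>: "0 < \<theta>" unfolding \<theta>_def by (rule theta_pos[OF H s])
  define \<delta> where "\<delta> = \<theta> * \<epsilon> / 2"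
  have \<delta>: "0 < \<delta>" using \<theta> assms(10) by (simp add: \<delta>_def)
  let ?p = "\<lambda>N. prob {\<omega> \<in> space M. strat_value H \<sigma> s0 \<xi> N N \<omega> > \<theta> * (1 - \<epsilon>)}"
  have trace: "\<forall>\<^sub>F N in sequentially. \<theta> * (1 - \<epsilon>/2) * real N \<le> (\<Sum>i = 1..N. lag_kernel H \<sigma> N i i)"
    by (rule lag_kernel_trace_eventually_ge[OF H s]) (use \<theta> assms(10) in \<open>simp add: \<theta>_def[symmetric]\<close>)
  \<comment> \<open>The threshold beyond which all prices are nonzero.\<close>
  have large: "\<forall>\<^sub>F N in sequentially. K * real N < real N powr (2 * H)"
  proof -
    have "(\<lambda>N. real N powr (1 - 2 * H)) \<longlonglongrightarrow> 0"
      by (rule tendsto_neg_powr) (use H filterlim_real_sequentially in auto)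
    then have "\<forall>\<^sub>F N in sequentially. real N powr (1 - 2 * H) < 1 / K"
      by (rule order_tendstoD) (use K in simp)
    then show ?thesis using eventually_gt_at_top[of 0]
    proof eventually_elim
      case (elim N)
      have "K * real N = K * real N powr (1 - 2 * H) * real N powr (2 * H)"
        using elim by (simp add: mult.assoc flip: powr_add)
      also have "\<dots> < 1 * real N powr (2 * H)"
        using elim K by (intro mult_strict_right_mono) (auto simp: field_simps)
      finally show ?case by simp
    qed
  qed
  \<comment> \<open>Chebyshev's inequality for the quadratic form, with variance of order \<open>N powr (2 * H)\<close>.\<close>
  have lower: "\<forall>\<^sub>F N in sequentially. 1 - 2 * C / \<delta>\<^sup>2 * real N powr (2 * H - 2) \<le> ?p N"
    using trace large eventually_ge_at_top[of 1]
  proof eventually_elim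
    case (elim N)
    define Q where "Q \<omega> = ((\<Sum>i = 1..N. \<Sum>l = 1..N. lag_kernel H \<sigma> N i l * (\<xi> i \<omega> * \<xi> l \<omega>))
                           - (\<Sum>i = 1..N. lag_kernel H \<sigma> N i i))\<^sup>2" for \<omega>
    have ind: "indep_vars (\<lambda>_. borel) \<xi> {1..N}"
      by (rule indep_vars_subset[OF assms(6)]) auto
    note var = random_sign_quadratic_form_variance[OF ind sq mean, of "lag_kernel H \<sigma> N", folded Q_def]
    have QI: "integrable M Q" and QE: "expectation Q \<le> 2 * (\<Sum>i = 1..N. \<Sum>l = 1..N. (lag_kernel H \<sigma> N i l)\<^sup>2)"
      by (rule var; simp)+
    have [measurable]: "Q \<in> borel_measurable M" using QI by auto
    have [measurable]: "(\<lambda>\<omega>. strat_value H \<sigma> s0 \<xi> N N \<omega>) \<in> borel_measurable M"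
      by (rule borel_measurable_strat_value[OF rv])
    have pos: "0 < (\<delta> * real N)\<^sup>2" using \<delta> elim by simp
    have "1 - ?p N = prob (space M - {\<omega> \<in> space M. strat_value H \<sigma> s0 \<xi> N N \<omega> > \<theta> * (1 - \<epsilon>)})"
      by (subst prob_compl) auto
    also have "\<dots> \<le> prob {\<omega> \<in> space M. (\<delta> * real N)\<^sup>2 \<le> Q \<omega>}"
    proof (rule finite_measure_mono_AE)
      show "AE \<omega> in M. \<omega> \<in> space M - {\<omega> \<in> space M. strat_value H \<sigma> s0 \<xi> N N \<omega> > \<theta> * (1 - \<epsilon>)}
              \<longrightarrow> \<omega> \<in> {\<omega> \<in> space M. (\<delta> * real N)\<^sup>2 \<le> Q \<omega>}"
        using ae
      proof eventually_elim
        case \<omega>: (elim \<omega>)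
        then show ?case
          using strat_value_small_imp_deviation[OF s0 elim(3) assms(10) \<theta> K(2) elim(2) elim(1), of \<xi> \<omega>]
          unfolding Q_def \<delta>_def by auto
      qed
    qed measurable
    also have "\<dots> \<le> expectation Q / (\<delta> * real N)\<^sup>2"
      by (rule integral_Markov_inequality_measure[OF QI, of "{}"]) (use pos in \<open>auto simp: Q_def\<close>)
    also have "\<dots> \<le> 2 * (C * real N powr (2 * H)) / (\<delta> * real N)\<^sup>2"
      using QE C[of N] pos by (intro divide_right_mono) auto
    also have "\<dots> = 2 * C / \<delta>\<^sup>2 * (real N powr (2 * H) / (real N)\<^sup>2)"
      by (simp add: power_mult_distrib)
    also have "real N powr (2 * H) / (real N)\<^sup>2 = real N powr (2 * H - 2)"
      using elim by (simp add: powr_diff)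
    finally show ?case by simp
  qed
  have "(\<lambda>N. real N powr (2 * H - 2)) \<longlonglongrightarrow> 0"
    by (rule tendsto_neg_powr) (use H filterlim_real_sequentially in auto)
  then have "(\<lambda>N. 1 - 2 * C / \<delta>\<^sup>2 * real N powr (2 * H - 2)) \<longlonglongrightarrow> 1 - 2 * C / \<delta>\<^sup>2 * 0"
    by (intro tendsto_intros)
  then have "?p \<longlonglongrightarrow> 1"
    by (intro tendsto_sandwich[OF lower _ _ tendsto_const]) auto
  then show ?thesis by (simp add: \<theta>_def)
qed

end
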